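(* Fix a positive integer $n$ and a field $k$, let $S=k[x_1,\ldots,x_n]$, and let $p=p(D)\in[0,1]$ be a function of $D$. For each positive integer $D$ let $M\sim\mathcal{M}(n,D,p)$ be a random monomial ideal. If $p\gg D^{-n+2-1/n}$, then asymptotically almost surely, as $D\to\infty$, $M$ is not Scarf.
   Context: The model $\mathcal{M}(n,D,p)$: a random set $G$ of monomials of $S=k[x_1,\ldots,x_n]$ is obtained by including each monomial of total degree exactly $D$ in $G$ independently with probability $p$ (and no other monomials); then $M=\langle G\rangle$. Since all elements of $G$ have the same degree, $G$ is the minimal monomial generating set of $M$. Here $n$ is fixed and $p$ may depend on $D$. For functions $f,g$ of $D$, $f\ll g$ (equivalently $g\gg f$) means $\lim_{D\to\infty}f(D)/g(D)=0$. An event holds asymptotically almost surely if its probability tends to $1$ as $D\to\infty$. Scarf ideals: let $M=\langle g_1,\ldots,g_r\rangle$ be a monomial ideal with minimal generating set $\{g_1,\ldots,g_r\}$. For $I\subseteq\{1,\ldots,r\}$ put $m_I=\operatorname{lcm}(g_i\mid i\in I)$, let $a_I\in\mathbb{N}^n$ be the exponent vector of $m_I$, and let $S(-a_I)$ be the free $S$-module with one generator $e_I$ in multidegree $a_I$. The Taylor complex of $S/M$ is $\mathcal{F}=\bigoplus_{I\subseteq\{1,\ldots,r\}}S(-a_I)$, with $e_I$ in homological degree $|I|$ and differential $d(e_I)=\sum_{i\in I}\operatorname{sign}(i,I)\,\frac{m_I}{m_{I\setminus i}}\,e_{I\setminus i}$, where $\operatorname{sign}(i,I)=(-1)^{j+1}$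 if $i$ is the $j$th element in the ordering of $I$; it is a free resolution of $S/M$. The Scarf complex of $M$ is the simplicial complex $\Delta_M=\{I\subseteq\{1,\ldots,r\}\mid m_I\neq m_J\text{ for all }J\subseteq\{1,\ldots,r\},\ J\neq I\}$. The algebraic Scarf complex $\mathcal{F}_{\Delta_M}$ is the subcomplex of the Taylor complex supported on $\Delta_M$ (spanned by the $e_I$ with $I\in\Delta_M$). $M$ is called Scarf if $\mathcal{F}_{\Delta_M}$ is a minimal free resolution of $S/M$.
   Formalization: The case n = 2 is excluded: every monomial ideal in two variables is Scarf, so the claim fails there for every p satisfying the hypothesis (e.g. p = 1). *)

theory Defs
  imports "HOL-Probability.Probability" "HOL-Library.Poly_Mapping"
begin

text \<open>The index type \<open>'n\<close> is the set of variables, so the number of variables is \<open>CARD('n)\<close>;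
  a monomial is represented by its exponent vector.\<close>

type_synonym 'n expvec = "'n \<Rightarrow>\<^sub>0 nat"
type_synonym ('n, 'k) mpoly = "('n \<Rightarrow>\<^sub>0 nat) \<Rightarrow>\<^sub>0 'k"

definition mpoly_monom :: "'n expvec \<Rightarrow> ('n, 'k::field) mpoly" where
  "mpoly_monom a = Poly_Mapping.single a 1"

definition total_degree :: "'n::finite expvec \<Rightarrow> nat" where
  "total_degree a = (\<Sum>v\<in>UNIV. Poly_Mapping.lookup a v)"

definition ideal_gen :: "('n, 'k::field) mpoly set \<Rightarrow> ('n, 'k) mpoly set" where
  "ideal_gen = module.span (*)"

definition irrelevant_ideal :: "('n, 'k::field) mpoly set" where
  "irrelevant_ideal = ideal_gen {mpoly_monom (Poly_Mapping.single v 1) | v. True}"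

definition minimal_generators :: "'n expvec set \<Rightarrow> ('n, 'k::field) mpoly set \<Rightarrow> bool" where
  "minimal_generators G M \<longleftrightarrow>
     ideal_gen (mpoly_monom ` G) = M \<and> (\<forall>H. H \<subset> G \<longrightarrow> ideal_gen (mpoly_monom ` H) \<noteq> M)"


text \<open>The free \<open>S\<close>-module on a set \<open>B\<close> of symbols consists of the finitely supported functions with
  support in \<open>B\<close>; the basis element \<open>e\<^sub>b\<close> is \<open>Poly_Mapping.single b 1\<close>.\<close>

definition free_scale ::
  "('n, 'k::field) mpoly \<Rightarrow> ('b \<Rightarrow>\<^sub>0 ('n, 'k) mpoly) \<Rightarrow> ('b \<Rightarrow>\<^sub>0 ('n, 'k) mpoly)" where
  "free_scale s = Poly_Mapping.map ((*) s)"

lemma lookup_free_scale: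
  "Poly_Mapping.lookup (free_scale s f) b = s * Poly_Mapping.lookup f b"
  by (simp add: free_scale_def Poly_Mapping.map.rep_eq when_def)

lemma module_free_scale: "module (free_scale :: ('n, 'k::field) mpoly \<Rightarrow> _)"
  by unfold_locales
    (auto intro!: poly_mapping_eqI simp: lookup_free_scale lookup_add algebra_simps)

definition free_module :: "'b set \<Rightarrow> ('b \<Rightarrow>\<^sub>0 ('n, 'k::field) mpoly) set" where
  "free_module B = {f. Poly_Mapping.keys f \<subseteq> B}"

text \<open>\<open>B p\<close> is the basis of the free module in homological degree \<open>p\<close>, and \<open>d p\<close> is the
  differential from degree \<open>p\<close> to degree \<open>p - 1\<close> (\<open>d 0\<close> is irrelevant).
  The map \<open>\<epsilon>\<close>, composed with the projection \<open>S \<rightarrow> S/M\<close>, is the augmentation \<open>F\<^sub>0 \<rightarrow> S/M\<close>; every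
  module map \<open>F\<^sub>0 \<rightarrow> S/M\<close> arises in this way because \<open>F\<^sub>0\<close> is free. The last two conditions on
  \<open>\<epsilon>\<close> say that the augmentation is onto and that its kernel is the image of \<open>d 1\<close>. Exactness
  includes that two consecutive differentials compose to zero.
  A module map defined only on \<open>free_module (B p)\<close> extends to all finitely supported functions,
  so requiring linearity of the total function is no restriction.\<close>

definition free_resolution ::
  "(nat \<Rightarrow> 'b set) \<Rightarrow> (nat \<Rightarrow> ('b \<Rightarrow>\<^sub>0 ('n, 'k::field) mpoly) \<Rightarrow> ('b \<Rightarrow>\<^sub>0 ('n, 'k) mpoly))
    \<Rightarrow> ('n, 'k) mpoly set \<Rightarrow> bool" where
  "free_resolution B d M \<longleftrightarrow>
     (\<forall>p\<ge>1. module_hom free_scale free_scale (d p) \<and>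
             d p ` free_module (B p) \<subseteq> free_module (B (p - 1))) \<and>
     (\<forall>p\<ge>1. {f \<in> free_module (B p). d p f = 0} = d (p + 1) ` free_module (B (p + 1))) \<and>
     (\<exists>\<epsilon>. module_hom free_scale (*) \<epsilon> \<and>
          (\<forall>s. \<exists>f\<in>free_module (B 0). s - \<epsilon> f \<in> M) \<and>
          {f \<in> free_module (B 0). \<epsilon> f \<in> M} = d 1 ` free_module (B 1))"

text \<open>Minimality: \<open>d(F\<^sub>p) \<subseteq> \<mm> F\<^bsub>p-1\<^esub>\<close> with \<open>\<mm> = (x\<^sub>1, \<dots>, x\<^sub>n)\<close>.\<close>

definition minimal_free_resolution ::
  "(nat \<Rightarrow> 'b set) \<Rightarrow> (nat \<Rightarrow> ('b \<Rightarrow>\<^sub>0 ('n, 'k::field) mpoly) \<Rightarrow> ('b \<Rightarrow>\<^sub>0 ('n, 'k) mpoly))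
    \<Rightarrow> ('n, 'k) mpoly set \<Rightarrow> bool" where
  "minimal_free_resolution B d M \<longleftrightarrow>
     free_resolution B d M \<and>
     (\<forall>p\<ge>1. \<forall>f\<in>free_module (B p). \<forall>b. Poly_Mapping.lookup (d p f) b \<in> irrelevant_ideal)"


text \<open>The generators \<open>g\<^sub>1, \<dots>, g\<^sub>r\<close> are given as a list of exponent vectors, so that the index
  set is \<open>{..<length gs}\<close>. The lcm of monomials is the pointwise maximum of exponents, and the
  lcm of the empty family is \<open>1\<close>.\<close>

definition lcm_exp :: "'n::finite expvec list \<Rightarrow> nat set \<Rightarrow> 'n expvec" where
  "lcm_exp gs I =
     Abs_poly_mapping (\<lambda>v. Max (insert 0 ((\<lambda>i. Poly_Mapping.lookup (gs ! i) v) ` I)))"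

lemma lookup_lcm_exp:
  "Poly_Mapping.lookup (lcm_exp gs I) v
     = Max (insert 0 ((\<lambda>i. Poly_Mapping.lookup (gs ! i) v) ` I))"
  by (simp add: lcm_exp_def Abs_poly_mapping_inverse)

text \<open>If \<open>i\<close> is the \<open>j\<close>-th element of \<open>I\<close>, then \<open>j - 1\<close> elements of \<open>I\<close> are smaller than \<open>i\<close>,
  and \<open>(-1)\<^bsup>j+1\<^esup> = (-1)\<^bsup>j-1\<^esup>\<close>. The module \<open>S(-a\<^sub>I)\<close> differs from \<open>S\<close> only in its grading, which
  plays no role for exactness and minimality.\<close>

definition taylor_sign :: "nat \<Rightarrow> nat set \<Rightarrow> ('n, 'k::field) mpoly" where
  "taylor_sign i I = (-1) ^ card {j \<in> I. j < i}"

definition taylor_diff ::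
  "'n::finite expvec list \<Rightarrow> (nat set \<Rightarrow>\<^sub>0 ('n, 'k::field) mpoly)
    \<Rightarrow> (nat set \<Rightarrow>\<^sub>0 ('n, 'k) mpoly)" where
  "taylor_diff gs f =
     (\<Sum>I\<in>Poly_Mapping.keys f. \<Sum>i\<in>I.
        Poly_Mapping.single (I - {i})
          (Poly_Mapping.lookup f I * taylor_sign i I
             * mpoly_monom (lcm_exp gs I - lcm_exp gs (I - {i}))))"

lemma taylor_diff_superset:
  assumes "finite A" "Poly_Mapping.keys f \<subseteq> A"
  shows "taylor_diff gs f = (\<Sum>I\<in>A. \<Sum>i\<in>I.
        Poly_Mapping.single (I - {i})
          (Poly_Mapping.lookup f I * taylor_sign i I
             * mpoly_monom (lcm_exp gs I - lcm_exp gs (I - {i}))))"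
  unfolding taylor_diff_def using assms
  by (intro sum.mono_neutral_left) (auto simp: in_keys_iff)

lemma taylor_diff_hom:
  "module_hom free_scale free_scale (taylor_diff gs :: _ \<Rightarrow> nat set \<Rightarrow>\<^sub>0 ('n::finite, 'k::field) mpoly)"
proof (intro module_hom.intro module_free_scale module_hom_axioms.intro)
  fix f g :: "nat set \<Rightarrow>\<^sub>0 ('n, 'k) mpoly" and s :: "('n, 'k) mpoly"
  let ?A = "Poly_Mapping.keys f \<union> Poly_Mapping.keys g"
  have "Poly_Mapping.keys (f + g) \<subseteq> ?A" by (rule Poly_Mapping.keys_add)
  then show "taylor_diff gs (f + g) = taylor_diff gs f + taylor_diff gs g"
    by (simp add: taylor_diff_superset[where A = ?A] lookup_add distrib_right single_add sum.distrib)
  have k: "Poly_Mapping.keys (free_scale s f) \<subseteq> Poly_Mapping.keys f"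
    by (auto simp: in_keys_iff lookup_free_scale)
  have e: "free_scale s (Poly_Mapping.single b x) = Poly_Mapping.single b (s * x)" for b :: "nat set" and x
    by (rule poly_mapping_eqI) (simp add: lookup_free_scale lookup_single when_def)
  show "taylor_diff gs (free_scale s f) = free_scale s (taylor_diff gs f)"
    unfolding taylor_diff_superset[OF finite_keys k] taylor_diff_superset[OF finite_keys subset_refl, where f = f]
    by (simp add: module.scale_sum_right[OF module_free_scale] e lookup_free_scale mult.assoc)
qed

definition scarf_complex :: "'n::finite expvec list \<Rightarrow> nat set set" where
  "scarf_complex gs =
     {I. I \<subseteq> {..<length gs} \<and>
         (\<forall>J. J \<subseteq> {..<length gs} \<longrightarrow> J \<noteq> I \<longrightarrow> lcm_exp gs J \<noteq> lcm_exp gs I)}"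

text \<open>Different orderings of the generators give isomorphic complexes, so it does not matter which
  enumeration is used. Every monomial ideal in at most two variables is Scarf.\<close>

definition is_scarf :: "('n::finite, 'k::field) mpoly set \<Rightarrow> bool" where
  "is_scarf M \<longleftrightarrow>
     (\<exists>gs. distinct gs \<and> minimal_generators (set gs) M \<and>
           minimal_free_resolution (\<lambda>p. {I \<in> scarf_complex gs. card I = p})
             (\<lambda>p. taylor_diff gs) M)"


definition monomials_of_degree :: "nat \<Rightarrow> 'n::finite expvec set" where
  "monomials_of_degree D = {a. total_degree a = D}"

lemma finite_monomials_of_degree: "finite (monomials_of_degree D :: 'n::finite expvec set)"
proof -
  have "inj_on Poly_Mapping.lookup (monomials_of_degree D :: 'n expvec set)"
    by (intro inj_onI) (simp add: poly_mapping_eqI)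
  moreover have "Poly_Mapping.lookup ` (monomials_of_degree D :: 'n expvec set)
      \<subseteq> PiE UNIV (\<lambda>_. {..D})"
    by (auto simp: monomials_of_degree_def total_degree_def intro: member_le_sum)
  moreover have "finite (PiE (UNIV :: 'n set) (\<lambda>_. {..D}))"
    by (rule finite_PiE) auto
  ultimately show ?thesis
    by (metis (no_types, lifting) finite_imageD finite_subset)
qed

definition random_generators :: "nat \<Rightarrow> real \<Rightarrow> 'n::finite expvec set pmf" where
  "random_generators D p =
     map_pmf (\<lambda>X. {a \<in> monomials_of_degree D. X a})
       (Pi_pmf (monomials_of_degree D) False (\<lambda>_. bernoulli_pmf p))"

definition random_monomial_ideal :: "nat \<Rightarrow> real \<Rightarrow> ('n::finite, 'k::field) mpoly set pmf" where
  "random_monomial_ideal D p = map_pmf (\<lambda>G. ideal_gen (mpoly_monom ` G)) (random_generators D p)"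

text \<open>Since \<open>x / 0 = 0\<close> in HOL, the limit of \<open>f D / g D\<close> only has its intended meaning if \<open>g\<close> is
  eventually nonzero.\<close>

definition much_less :: "(nat \<Rightarrow> real) \<Rightarrow> (nat \<Rightarrow> real) \<Rightarrow> bool" where
  "much_less f g \<longleftrightarrow>
     (\<forall>\<^sub>F D in sequentially. g D \<noteq> 0) \<and> (\<lambda>D. f D / g D) \<longlonglongrightarrow> 0"

definition asymptotically_almost_surely :: "(nat \<Rightarrow> 'a pmf) \<Rightarrow> ('a \<Rightarrow> bool) \<Rightarrow> bool" where
  "asymptotically_almost_surely X P \<longleftrightarrow>
     (\<lambda>D. measure_pmf.prob (X D) {x. P x}) \<longlonglongrightarrow> 1"

end

theory Submission
  imports Defs
begin

text \<open>A Scarf complex that resolves \<open>S/M\<close> receives a chain map from the Taylor complex on any chosen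
  generators \<open>y\<^sub>0, \<dots>, y\<^bsub>N-1\<^esub>\<close>, respecting divisibility of labels. If a vertex map \<open>\<tau>\<close> to
  \<open>{0, \<dots>, N-1}\<close> sends every generator dividing the lcm of \<open>y\<^sub>i\<close>, \<open>i \<in> A\<close>, into \<open>A\<close>, then the
  composite with \<open>\<tau>\<close> is the identity on the full simplex, so some Scarf face is mapped
  bijectively onto \<open>{0, \<dots>, N-1}\<close>. A configuration of generators below a corner in which every
  such face shares its label with a larger set is therefore an obstruction.

  For \<open>n\<close> variables such a configuration consists of one generator on each of the \<open>n\<close> facets of a
  simplex of monomials and one more that ties with the first. With \<open>b \<approx> p\<^bsup>-1/(n-1)\<^esup>\<close>, a simplex
  of side of order \<open>b\<close> contains a bounded expected number of generators, and these form exactly such a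
  configuration with probability of order at least \<open>1/b\<close>. There are about \<open>(D/b)\<^bsup>n-1\<^esup>\<close>
  disjoint, hence independent, simplices, and \<open>D\<^bsup>n-1\<^esup>/b\<^bsup>n\<^esup>\<close> tends to infinity above the threshold.
  For \<open>p > 1/2\<close> simplices of side \<open>1\<close> all of whose monomials are generators do the job.\<close>

subsection \<open>Exponent vectors and monomial ideals\<close>

definition exp_dvd :: "'n expvec \<Rightarrow> 'n expvec \<Rightarrow> bool" (infix "\<preceq>" 50) where
  "a \<preceq> b \<longleftrightarrow> (\<forall>v. Poly_Mapping.lookup a v \<le> Poly_Mapping.lookup b v)"

lemma exp_dvd_refl [simp]: "a \<preceq> a"
  by (simp add: exp_dvd_def)

lemma exp_dvd_trans [trans]: "a \<preceq> b \<Longrightarrow> b \<preceq> c \<Longrightarrow> a \<preceq> c"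
  by (meson exp_dvd_def order_trans)

lemma exp_dvd_antisym: "a \<preceq> b \<Longrightarrow> b \<preceq> a \<Longrightarrow> a = b"
  by (metis exp_dvd_def order_antisym poly_mapping_eqI)

lemma exp_dvd_iff_add: "a \<preceq> b \<longleftrightarrow> (\<exists>c. b = a + c)"
proof
  assume "a \<preceq> b"
  then have "b = a + (b - a)"
    by (intro poly_mapping_eqI) (simp add: exp_dvd_def lookup_add lookup_minus)
  then show "\<exists>c. b = a + c" ..
qed (auto simp: exp_dvd_def lookup_add)

lemma exp_dvd_diff_add: "a \<preceq> b \<Longrightarrow> (b - a) + a = b"
  by (auto simp: exp_dvd_iff_add add.commute)

lemma exp_diff_add_diff: "a \<preceq> b \<Longrightarrow> b \<preceq> c \<Longrightarrow> (c - b) + (b - a) = c - a"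
  by (intro poly_mapping_eqI) (simp add: exp_dvd_def lookup_add lookup_minus)

lemma exp_dvd_same_degree:
  assumes "a \<preceq> b" "total_degree a = total_degree b"
  shows "a = b"
proof (rule poly_mapping_eqI, rule ccontr)
  fix v assume "Poly_Mapping.lookup a v \<noteq> Poly_Mapping.lookup b v"
  then have "Poly_Mapping.lookup a v < Poly_Mapping.lookup b v"
    using assms(1) by (simp add: exp_dvd_def order_less_le)
  then have "total_degree a < total_degree b"
    unfolding total_degree_def using assms(1) by (intro sum_strict_mono_ex1) (auto simp: exp_dvd_def)
  with assms(2) show False by simp
qed

section \<open>Monomials and monomial ideals in the polynomial ring\<close>

lemma mpoly_monom_mult: "mpoly_monom a * mpoly_monom b = mpoly_monom (a + b)"
  by (simp add: mpoly_monom_def mult_single)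

lemma lookup_monom_mult:
  "Poly_Mapping.lookup (mpoly_monom b * f) (b + a) = Poly_Mapping.lookup f a"
  by (simp add: mpoly_monom_def lookup_mult lookup_single when_mult)

lemma keys_monom_mult: "k \<in> Poly_Mapping.keys (mpoly_monom b * f) \<Longrightarrow> b \<preceq> k"
  using keys_mult[of "mpoly_monom b" f] by (auto simp: mpoly_monom_def exp_dvd_iff_add)

lemma lookup_monom_mult_eq_0: "\<not> b \<preceq> k \<Longrightarrow> Poly_Mapping.lookup (mpoly_monom b * f) k = 0"
  by (meson in_keys_iff keys_monom_mult)

lemma lookup_coeff_monom_mult_eq_0:
  assumes "\<not> b \<preceq> k"
  shows "Poly_Mapping.lookup (c * mpoly_monom b * f) k = 0"
  using lookup_monom_mult_eq_0[OF assms, of "c * f"] by (simp add: mult_ac)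

lemma module_mpoly: "module ((*) :: ('n, 'k::field) mpoly \<Rightarrow> _)"
  by unfold_locales (auto simp: algebra_simps)

text \<open>The polynomials all of whose terms are divisible by members of \<open>G\<close> form a
  submodule \<open>?K\<close> containing the generators, hence containing the ideal. A monomial
  lying in \<open>?K\<close> has its divisor in \<open>G\<close>.\<close>

lemma monom_in_ideal_gen_iff:
  "(mpoly_monom a :: ('n, 'k::field) mpoly) \<in> ideal_gen (mpoly_monom ` G) \<longleftrightarrow> (\<exists>g\<in>G. g \<preceq> a)"
proof
  interpret module "(*) :: ('n, 'k) mpoly \<Rightarrow> _" by (rule module_mpoly)
  let ?K = "{f :: ('n, 'k) mpoly. \<forall>b\<in>Poly_Mapping.keys f. \<exists>g\<in>G. g \<preceq> b}"
  {
    assume *: "(mpoly_monom a :: ('n, 'k) mpoly) \<in> ideal_gen (mpoly_monom ` G)"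
    have "subspace ?K"
    proof (rule subspaceI)
      fix f h assume "f \<in> ?K" "h \<in> ?K"
      then show "f + h \<in> ?K" using keys_add[of f h] by blast
    next
      fix s f assume f: "f \<in> ?K"
      show "s * f \<in> ?K"
      proof (intro CollectI ballI)
        fix b assume "b \<in> Poly_Mapping.keys (s * f)"
        then obtain x y where b: "b = x + y" "y \<in> Poly_Mapping.keys f"
          using keys_mult[of s f] by auto
        then obtain g where "g \<in> G" "g \<preceq> y" using f by auto
        moreover have "y \<preceq> b" unfolding b exp_dvd_iff_add by (metis add.commute)
        ultimately show "\<exists>g\<in>G. g \<preceq> b" using exp_dvd_trans by blast
      qed
    qed auto
    moreover have "mpoly_monom ` G \<subseteq> ?K" by (auto simp: mpoly_monom_def intro: exp_dvd_refl bexI)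
    ultimately have "span (mpoly_monom ` G) \<subseteq> ?K" by (rule span_minimal[rotated])
    with * have "(mpoly_monom a :: ('n, 'k) mpoly) \<in> ?K" unfolding ideal_gen_def by blast
    then show "\<exists>g\<in>G. g \<preceq> a" by (simp add: mpoly_monom_def)
  next
    assume "\<exists>g\<in>G. g \<preceq> a"
    then obtain g c where "g \<in> G" "a = c + g" by (auto simp: exp_dvd_iff_add add.commute)
    then show "(mpoly_monom a :: ('n, 'k) mpoly) \<in> ideal_gen (mpoly_monom ` G)"
      unfolding ideal_gen_def by (auto simp flip: mpoly_monom_mult intro!: span_scale intro: span_base)
  }
qed

lemma ideal_gen_monom_subset:
  assumes "\<And>h. h \<in> H \<Longrightarrow> \<exists>g\<in>G. g \<preceq> h"
  shows "(ideal_gen (mpoly_monom ` H) :: ('n, 'k::field) mpoly set) \<subseteq> ideal_gen (mpoly_monom ` G)"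
proof -
  interpret module "(*) :: ('n, 'k) mpoly \<Rightarrow> _" by (rule module_mpoly)
  have "mpoly_monom ` H \<subseteq> (ideal_gen (mpoly_monom ` G) :: ('n, 'k) mpoly set)"
    using assms by (auto simp: monom_in_ideal_gen_iff)
  then show ?thesis unfolding ideal_gen_def by (intro span_minimal subspace_span)
qed

text \<open>This pins down the generators that \<open>is_scarf\<close> quantifies over. By
  minimality no member of \<open>H\<close> divides another, so a chain
  \<open>h' \<preceq> g \<preceq> h\<close> collapses and gives \<open>H \<subseteq> G\<close>;
  conversely a member of \<open>H\<close> dividing \<open>g\<close> has the same degree as
  \<open>g\<close> and equals it.\<close>

lemma minimal_generators_unique:
  assumes "minimal_generators H (ideal_gen (mpoly_monom ` G) :: ('n::finite, 'k::field) mpoly set)"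
    and G: "G \<subseteq> monomials_of_degree D"
  shows "H = G"
proof -
  let ?M = "ideal_gen (mpoly_monom ` G) :: ('n, 'k) mpoly set"
  have gen: "ideal_gen (mpoly_monom ` H) = ?M"
    and min: "\<And>H'. H' \<subset> H \<Longrightarrow> ideal_gen (mpoly_monom ` H') \<noteq> ?M"
    using assms(1) by (auto simp: minimal_generators_def)
  have dvd: "(\<exists>h\<in>H. h \<preceq> a) \<longleftrightarrow> (\<exists>g\<in>G. g \<preceq> a)" for a
    using gen monom_in_ideal_gen_iff[of a H, where 'k = 'k] monom_in_ideal_gen_iff[of a G, where 'k = 'k]
    by simp
  have irred: "h' = h" if h: "h \<in> H" "h' \<in> H" "h' \<preceq> h" for h h'
  proof (rule ccontr)
    assume ne: "h' \<noteq> h"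
    have "\<exists>l\<in>H - {h}. l \<preceq> k" if "k \<in> H" for k
      using that h ne exp_dvd_refl by (cases "k = h") blast+
    then have "ideal_gen (mpoly_monom ` H) \<subseteq> (ideal_gen (mpoly_monom ` (H - {h})) :: ('n, 'k) mpoly set)"
      by (intro ideal_gen_monom_subset)
    moreover have "(ideal_gen (mpoly_monom ` (H - {h})) :: ('n, 'k) mpoly set) \<subseteq> ideal_gen (mpoly_monom ` H)"
      by (intro ideal_gen_monom_subset) (blast intro: exp_dvd_refl)
    ultimately show False using min[of "H - {h}"] gen h(1) by auto
  qed
  show ?thesis
  proof
    show "H \<subseteq> G"
    proof
      fix h assume h: "h \<in> H"
      then obtain g where g: "g \<in> G" "g \<preceq> h" using dvd exp_dvd_refl by blast
      then obtain h' where h': "h' \<in> H" "h' \<preceq> g" using dvd exp_dvd_refl by blast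
      then have "h' = h" using irred[OF h] exp_dvd_trans g(2) by blast
      then have "h = g" using g(2) h'(2) exp_dvd_antisym by blast
      with g(1) show "h \<in> G" by simp
    qed
    show "G \<subseteq> H"
    proof
      fix g assume g: "g \<in> G"
      then obtain h where h: "h \<in> H" "h \<preceq> g" using dvd exp_dvd_refl by blast
      then have "h \<in> G" using \<open>H \<subseteq> G\<close> by blast
      then have "h = g" using h(2) g G by (intro exp_dvd_same_degree) (auto simp: monomials_of_degree_def)
      with h(1) show "g \<in> H" by simp
    qed
  qed
qed

subsection \<open>Sign cochains\<close>

text \<open>The Taylor sign as an integer: the cochain identities are proved over the integers and
  carried by \<open>of_int\<close> to every field.\<close>

definition incidence_sign :: "nat \<Rightarrow> nat set \<Rightarrow> int" where
  "incidence_sign i I = (-1) ^ card {j \<in> I. j < i}"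

lemma taylor_sign_eq: "taylor_sign i I = of_int (incidence_sign i I)"
  by (simp add: taylor_sign_def incidence_sign_def)

lemma incidence_sign_cases: "incidence_sign i I = 1 \<or> incidence_sign i I = -1"
  by (simp add: incidence_sign_def minus_one_power_iff)

lemma incidence_sign_remove:
  assumes "finite L" "h \<in> L" "g \<noteq> h"
  shows "incidence_sign g (L - {h}) = (if h < g then - incidence_sign g L else incidence_sign g L)"
proof (cases "h < g")
  case True
  have e: "{j \<in> L - {h}. j < g} = {j \<in> L. j < g} - {h}" by auto
  have "card {j \<in> L. j < g} = Suc (card {j \<in> L - {h}. j < g})"
    unfolding e using assms True by (intro card_Suc_Diff1[symmetric]) auto
  then show ?thesis using True by (simp add: incidence_sign_def)
next
  case False
  then have "{j \<in> L - {h}. j < g} = {j \<in> L. j < g}" using assms by auto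
  then show ?thesis using False by (simp add: incidence_sign_def)
qed

text \<open>The sign rule behind the vanishing of two consecutive boundaries.\<close>

lemma incidence_sign_swap:
  assumes "finite L" "g \<in> L" "h \<in> L" "g \<noteq> h"
  shows "incidence_sign g L * incidence_sign h (L - {g}) = - (incidence_sign h L * incidence_sign g (L - {h}))"
  using assms by (auto simp: incidence_sign_remove)

text \<open>The part with \<open>i < l\<close> is the negative of the part with
  \<open>l < i\<close>. Splitting the sum, rather than comparing it with its own negative, keeps the
  argument valid in characteristic 2.\<close>

lemma sum_antisym_pairs:
  fixes f :: "nat \<Rightarrow> nat \<Rightarrow> 'a::ab_group_add"
  assumes "finite A" and anti: "\<And>i l. i \<in> A \<Longrightarrow> l \<in> A \<Longrightarrow> i \<noteq> l \<Longrightarrow> f i l = - f l i"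
  shows "(\<Sum>i\<in>A. \<Sum>l\<in>A - {i}. f i l) = 0"
proof -
  have "(\<Sum>i\<in>A. \<Sum>l\<in>A - {i}. f i l)
      = (\<Sum>i\<in>A. (\<Sum>l | l \<in> A \<and> l < i. f i l) + (\<Sum>l | l \<in> A \<and> i < l. f i l))"
  proof (rule sum.cong[OF refl])
    fix i assume "i \<in> A"
    have "A - {i} = {l \<in> A. l < i} \<union> {l \<in> A. i < l}" by auto
    then show "(\<Sum>l\<in>A - {i}. f i l) = (\<Sum>l | l \<in> A \<and> l < i. f i l) + (\<Sum>l | l \<in> A \<and> i < l. f i l)"
      using assms(1) by (simp add: sum.union_disjoint disjoint_iff)
  qed
  also have "\<dots> = (\<Sum>i\<in>A. \<Sum>l | l \<in> A \<and> l < i. f i l) + (\<Sum>i\<in>A. \<Sum>l | l \<in> A \<and> i < l. f i l)"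
    by (rule sum.distrib)
  also have "(\<Sum>i\<in>A. \<Sum>l | l \<in> A \<and> i < l. f i l) = (\<Sum>l\<in>A. \<Sum>i | i \<in> A \<and> i < l. f i l)"
    by (rule sum.swap_restrict) (use assms(1) in auto)
  also have "\<dots> = (\<Sum>l\<in>A. \<Sum>i | i \<in> A \<and> i < l. - f l i)"
    by (intro sum.cong refl anti) auto
  also have "\<dots> = - (\<Sum>l\<in>A. \<Sum>i | i \<in> A \<and> i < l. f l i)"
    by (simp add: sum_negf)
  finally show ?thesis by simp
qed

text \<open>The pull-back along the vertex map \<open>t\<close> of the cochain on simplices with \<open>k\<close> vertices that is
  \<open>\<plusminus>1\<close> on the simplex \<open>{..<k}\<close> and zero on all others.\<close>

fun pullback_cochain :: "(nat \<Rightarrow> nat) \<Rightarrow> nat \<Rightarrow> nat set \<Rightarrow> int" where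
  "pullback_cochain t 0 J = (if J = {} then 1 else 0)"
| "pullback_cochain t (Suc k) J =
     (\<Sum>g | g \<in> J \<and> t g = k. incidence_sign g J * pullback_cochain t k (J - {g}))"

lemma pullback_cochain_nonzero_imp:
  "pullback_cochain t k J \<noteq> 0 \<Longrightarrow> i < k \<Longrightarrow> i \<in> t ` J"
proof (induction k arbitrary: J)
  case (Suc k)
  from Suc.prems(1) obtain g where g: "g \<in> J" "t g = k" "pullback_cochain t k (J - {g}) \<noteq> 0"
    by (auto elim!: sum.not_neutral_contains_not_neutral)
  show ?case
  proof (cases "i = k")
    case False
    then have "i < k" using Suc.prems(2) by simp
    from Suc.IH[OF g(3) this] show ?thesis by auto
  qed (use g in auto)
qed simp

text \<open>Unfolding one level removes a second vertex \<open>h\<close> over \<open>k\<close>.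
  After the two sums are exchanged, the terms with \<open>t g < k\<close> vanish by the induction
  hypothesis for \<open>L - {h}\<close>, and those with \<open>g\<close> and \<open>h\<close> both
  over \<open>k\<close> cancel in pairs.\<close>

lemma pullback_cochain_cocycle:
  assumes "finite L"
  shows "(\<Sum>g | g \<in> L \<and> t g < k. incidence_sign g L * pullback_cochain t k (L - {g})) = 0"
  using assms
proof (induction k arbitrary: L)
  case (Suc k)
  let ?s = incidence_sign and ?\<alpha> = "pullback_cochain t"
  let ?K = "{h \<in> L. t h = k}" and ?U = "{g \<in> L. t g < Suc k}"
  have fin: "finite ?K" "finite ?U" using Suc.prems by auto
  have "(\<Sum>g\<in>?U. ?s g L * ?\<alpha> (Suc k) (L - {g}))
      = (\<Sum>g\<in>?U. \<Sum>h | h \<in> ?K \<and> g \<noteq> h. ?s g L * ?s h (L - {g}) * ?\<alpha> k (L - {g} - {h}))"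
  proof (rule sum.cong[OF refl])
    fix g
    have "{h. h \<in> L - {g} \<and> t h = k} = {h. h \<in> ?K \<and> g \<noteq> h}" by auto
    then show "?s g L * ?\<alpha> (Suc k) (L - {g})
        = (\<Sum>h | h \<in> ?K \<and> g \<noteq> h. ?s g L * ?s h (L - {g}) * ?\<alpha> k (L - {g} - {h}))"
      by (simp only: pullback_cochain.simps sum_distrib_left mult.assoc)
  qed
  also have "\<dots> = (\<Sum>h\<in>?K. \<Sum>g | g \<in> ?U \<and> g \<noteq> h. ?s g L * ?s h (L - {g}) * ?\<alpha> k (L - {g} - {h}))"
    by (rule sum.swap_restrict[OF fin(2) fin(1)])
  also have "\<dots> = (\<Sum>h\<in>?K. - ?s h L * (\<Sum>g | g \<in> ?U \<and> g \<noteq> h. ?s g (L - {h}) * ?\<alpha> k (L - {h} - {g})))"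
  proof (rule sum.cong[OF refl], unfold sum_distrib_left, rule sum.cong[OF refl])
    fix h g assume h: "h \<in> ?K" and g: "g \<in> {g \<in> ?U. g \<noteq> h}"
    have "?s g L * ?s h (L - {g}) = - (?s h L * ?s g (L - {h}))"
      using h g Suc.prems by (intro incidence_sign_swap) auto
    moreover have "L - {g} - {h} = L - {h} - {g}" by auto
    ultimately show "?s g L * ?s h (L - {g}) * ?\<alpha> k (L - {g} - {h})
        = - ?s h L * (?s g (L - {h}) * ?\<alpha> k (L - {h} - {g}))"
      by simp
  qed
  also have "\<dots> = (\<Sum>h\<in>?K. - ?s h L * (\<Sum>g\<in>?K - {h}. ?s g (L - {h}) * ?\<alpha> k (L - {h} - {g})))"
  proof (rule sum.cong[OF refl])
    fix h assume "h \<in> ?K"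
    have "(\<Sum>g | g \<in> ?U \<and> g \<noteq> h. ?s g (L - {h}) * ?\<alpha> k (L - {h} - {g}))
        = (\<Sum>g | g \<in> L - {h} \<and> t g < k. ?s g (L - {h}) * ?\<alpha> k (L - {h} - {g}))
          + (\<Sum>g\<in>?K - {h}. ?s g (L - {h}) * ?\<alpha> k (L - {h} - {g}))"
    proof -
      have "sum f {g \<in> ?U. g \<noteq> h} = sum f {g \<in> L - {h}. t g < k} + sum f (?K - {h})" for f :: "nat \<Rightarrow> int"
      proof -
        have "{g \<in> ?U. g \<noteq> h} = {g \<in> L - {h}. t g < k} \<union> (?K - {h})" by auto
        moreover have "sum f ({g \<in> L - {h}. t g < k} \<union> (?K - {h})) = sum f {g \<in> L - {h}. t g < k} + sum f (?K - {h})"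
          using Suc.prems by (intro sum.union_disjoint) auto
        ultimately show ?thesis by metis
      qed
      then show ?thesis .
    qed
    then show "- ?s h L * (\<Sum>g | g \<in> ?U \<and> g \<noteq> h. ?s g (L - {h}) * ?\<alpha> k (L - {h} - {g}))
        = - ?s h L * (\<Sum>g\<in>?K - {h}. ?s g (L - {h}) * ?\<alpha> k (L - {h} - {g}))"
      using Suc.IH[of "L - {h}"] Suc.prems by simp
  qed
  also have "\<dots> = (\<Sum>h\<in>?K. \<Sum>g\<in>?K - {h}. - (?s h L * ?s g (L - {h}) * ?\<alpha> k (L - {h} - {g})))"
    by (simp add: sum_distrib_left mult.assoc)
  also have "\<dots> = 0"
  proof (rule sum_antisym_pairs[OF fin(1)])
    fix h g assume "h \<in> ?K" "g \<in> ?K" "h \<noteq> g"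
    then have "?s h L * ?s g (L - {h}) = - (?s g L * ?s h (L - {g}))"
      using Suc.prems by (intro incidence_sign_swap) auto
    moreover have "L - {g} - {h} = L - {h} - {g}" by auto
    ultimately show "- (?s h L * ?s g (L - {h}) * ?\<alpha> k (L - {h} - {g}))
        = - (- (?s g L * ?s h (L - {g}) * ?\<alpha> k (L - {g} - {h})))"
      by simp
  qed
  finally show ?case .
qed simp

text \<open>The removed vertices with \<open>t g < k\<close> contribute zero by
  \<open>pullback_cochain_cocycle\<close>; those with \<open>t g = k\<close> give the recursion
  defining the next cochain.\<close>

lemma pullback_cochain_coboundary:
  assumes "finite L" "t ` L \<subseteq> {..k}"
  shows "(\<Sum>g\<in>L. incidence_sign g L * pullback_cochain t k (L - {g})) = pullback_cochain t (Suc k) L"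
proof -
  let ?f = "\<lambda>g. incidence_sign g L * pullback_cochain t k (L - {g})"
  have "sum ?f L = sum ?f ({g \<in> L. t g < k} \<union> {g \<in> L. t g = k})"
    using assms(2) by (intro sum.cong) fastforce+
  also have "\<dots> = sum ?f {g \<in> L. t g < k} + sum ?f {g \<in> L. t g = k}"
    using assms(1) by (intro sum.union_disjoint) auto
  finally show ?thesis using pullback_cochain_cocycle[OF assms(1), of t k] by simp
qed

subsection \<open>A criterion for not being Scarf\<close>

lemma nth_dvd_lcm_exp: "finite I \<Longrightarrow> i \<in> I \<Longrightarrow> gs ! i \<preceq> lcm_exp gs I"
  unfolding exp_dvd_def lookup_lcm_exp by (auto intro!: Max_ge)

lemma lcm_exp_dvd: "finite I \<Longrightarrow> (\<And>i. i \<in> I \<Longrightarrow> gs ! i \<preceq> b) \<Longrightarrow> lcm_exp gs I \<preceq> b"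
  unfolding exp_dvd_def lookup_lcm_exp by auto

lemma lcm_exp_mono: "finite J \<Longrightarrow> I \<subseteq> J \<Longrightarrow> lcm_exp gs I \<preceq> lcm_exp gs J"
  by (intro lcm_exp_dvd nth_dvd_lcm_exp) (auto intro: finite_subset)

lemma lcm_exp_empty [simp]: "lcm_exp gs {} = 0"
  by (intro poly_mapping_eqI) (simp add: lookup_lcm_exp)

lemma lcm_exp_singleton [simp]: "lcm_exp gs {i} = gs ! i"
  by (intro poly_mapping_eqI) (simp add: lookup_lcm_exp)

section \<open>Cochains as linear forms on the Taylor module\<close>

lemma free_module_add: "f \<in> free_module B \<Longrightarrow> g \<in> free_module B \<Longrightarrow> f + g \<in> free_module B"
  using keys_add[of f g] by (auto simp: free_module_def)

lemma free_module_scale: "f \<in> free_module B \<Longrightarrow> free_scale s f \<in> free_module B"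
  by (force simp: free_module_def in_keys_iff lookup_free_scale)

lemma free_module_sum: "(\<And>i. i \<in> I \<Longrightarrow> f i \<in> free_module B) \<Longrightarrow> sum f I \<in> free_module B"
  by (induction I rule: infinite_finite_induct) (auto simp: free_module_add, auto simp: free_module_def)

text \<open>Weighting each face by its label homogenizes the cochain: only faces whose label divides
  \<open>a\<close> contribute to the coefficient at \<open>a\<close>.\<close>

definition pullback_form ::
  "'n::finite expvec list \<Rightarrow> (nat \<Rightarrow> nat) \<Rightarrow> nat \<Rightarrow> (nat set \<Rightarrow>\<^sub>0 ('n, 'k::field) mpoly) \<Rightarrow> ('n, 'k) mpoly" where
  "pullback_form gs t k f = (\<Sum>J\<in>Pow {..<length gs}.
     of_int (pullback_cochain t k J) * mpoly_monom (lcm_exp gs J) * Poly_Mapping.lookup f J)"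

lemma pullback_form_scale:
  "pullback_form gs t k (free_scale s f) = s * pullback_form gs t k f"
  by (simp add: pullback_form_def lookup_free_scale sum_distrib_left algebra_simps)

lemma pullback_form_sum:
  "pullback_form gs t k (sum f I) = (\<Sum>i\<in>I. pullback_form gs t k (f i))"
  unfolding pullback_form_def lookup_sum sum_distrib_left by (rule sum.swap)

lemma pullback_form_single:
  assumes "J \<subseteq> {..<length gs}"
  shows "pullback_form gs t k (Poly_Mapping.single J s)
    = of_int (pullback_cochain t k J) * mpoly_monom (lcm_exp gs J) * s"
proof -
  have "pullback_form gs t k (Poly_Mapping.single J s) = (\<Sum>I\<in>Pow {..<length gs}.
     if J = I then of_int (pullback_cochain t k J) * mpoly_monom (lcm_exp gs J) * s else 0)"
    unfolding pullback_form_def by (intro sum.cong) (auto simp: lookup_single)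
  then show ?thesis using assms by simp
qed

text \<open>The monomial factor of the Taylor differential times the label of \<open>I - {i}\<close>
  is the label of \<open>I\<close>, so composing the form with the differential amounts to taking
  the coboundary of the cochain.\<close>

lemma pullback_form_taylor_diff:
  assumes "Poly_Mapping.keys f \<subseteq> Pow {..<length gs}"
  shows "pullback_form gs t k (taylor_diff gs f) = (\<Sum>I\<in>Pow {..<length gs}.
    of_int (\<Sum>i\<in>I. incidence_sign i I * pullback_cochain t k (I - {i}))
      * mpoly_monom (lcm_exp gs I) * Poly_Mapping.lookup f I)"
proof -
  have *: "pullback_form gs t k (Poly_Mapping.single (I - {i}) (Poly_Mapping.lookup f I * taylor_sign i I
             * mpoly_monom (lcm_exp gs I - lcm_exp gs (I - {i}))))
      = of_int (incidence_sign i I * pullback_cochain t k (I - {i}))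
          * (mpoly_monom (lcm_exp gs I) * Poly_Mapping.lookup f I)"
    if I: "I \<subseteq> {..<length gs}" for I i
  proof -
    have "lcm_exp gs (I - {i}) \<preceq> lcm_exp gs I"
      using I by (intro lcm_exp_mono) (auto intro: finite_subset)
    then have "mpoly_monom (lcm_exp gs I) = (mpoly_monom (lcm_exp gs I - lcm_exp gs (I - {i}))
        * mpoly_monom (lcm_exp gs (I - {i})) :: ('a, 'b) mpoly)"
      by (simp add: mpoly_monom_mult exp_dvd_diff_add)
    moreover have "I - {i} \<subseteq> {..<length gs}" using I by auto
    ultimately show ?thesis
      by (simp only: pullback_form_single taylor_sign_eq of_int_mult mult_ac)
  qed
  show ?thesis
    unfolding taylor_diff_superset[OF finite_Pow_iff[THEN iffD2, OF finite_lessThan] assms]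
      pullback_form_sum
    by (rule sum.cong[OF refl])
      (simp only: * Pow_iff sum_distrib_right of_int_sum mult.assoc[of "of_int _"])
qed

text \<open>A vertex outside \<open>{..k}\<close> would make the label too large, so in this multidegree only the
  faces on which \<open>pullback_cochain_coboundary\<close> applies contribute.\<close>

lemma lookup_pullback_form_taylor_diff:
  assumes keys: "Poly_Mapping.keys f \<subseteq> Pow {..<length gs}"
    and le: "\<And>j. j < length gs \<Longrightarrow> gs ! j \<preceq> a \<Longrightarrow> t j \<le> k"
  shows "Poly_Mapping.lookup (pullback_form gs t k (taylor_diff gs f)) a
    = Poly_Mapping.lookup (pullback_form gs t (Suc k) f) a"
  unfolding pullback_form_taylor_diff[OF keys] unfolding pullback_form_def lookup_sum
proof (rule sum.cong[OF refl])
  fix I assume "I \<in> Pow {..<length gs}"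
  then have I: "finite I" "I \<subseteq> {..<length gs}" by (auto intro: finite_subset)
  show "Poly_Mapping.lookup (of_int (\<Sum>i\<in>I. incidence_sign i I * pullback_cochain t k (I - {i}))
      * mpoly_monom (lcm_exp gs I) * Poly_Mapping.lookup f I) a
    = Poly_Mapping.lookup (of_int (pullback_cochain t (Suc k) I)
      * mpoly_monom (lcm_exp gs I) * Poly_Mapping.lookup f I) a"
  proof (cases "lcm_exp gs I \<preceq> a")
    case True
    have "t j \<le> k" if "j \<in> I" for j
      using that I True by (intro le exp_dvd_trans[OF nth_dvd_lcm_exp]) auto
    then have "t ` I \<subseteq> {..k}" by auto
    then show ?thesis using pullback_cochain_coboundary[OF I(1)] by simp
  next
    case False
    then show ?thesis by (simp add: lookup_coeff_monom_mult_eq_0)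
  qed
qed

text \<open>The comparison theorem for the Taylor complex on the generators \<open>gs ! c i\<close>:
  the chain map \<phi> is built by induction on \<open>card A\<close>, each new value being a lift
  that exactness provides.\<close>

lemma scarf_resolution_lift:
  fixes M :: "('n::finite, 'k::field) mpoly set" and gs :: "'n expvec list"
  defines "F \<equiv> \<lambda>p. free_module {I \<in> scarf_complex gs. card I = p} :: (nat set \<Rightarrow>\<^sub>0 ('n, 'k) mpoly) set"
  assumes res: "free_resolution (\<lambda>p. {I \<in> scarf_complex gs. card I = p}) (\<lambda>p. taylor_diff gs) M"
    and M: "M = ideal_gen (mpoly_monom ` set gs)"
    and nz: "0 \<notin> set gs"
    and c: "c ` {..<N} \<subseteq> {..<length gs}"
  defines "m \<equiv> \<lambda>A. lcm_exp gs (c ` A)"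
  shows "\<exists>\<phi>. \<phi> {} = Poly_Mapping.single {} 1 \<and> (\<forall>A\<subseteq>{..<N}. \<phi> A \<in> F (card A) \<and>
    (A \<noteq> {} \<longrightarrow> taylor_diff gs (\<phi> A)
       = (\<Sum>i\<in>A. free_scale (taylor_sign i A * mpoly_monom (m A - m (A - {i}))) (\<phi> (A - {i})))))"
proof -
  let ?d = "taylor_diff gs :: (nat set \<Rightarrow>\<^sub>0 ('n, 'k) mpoly) \<Rightarrow> _"
  define s :: "nat \<Rightarrow> nat set \<Rightarrow> ('n, 'k) mpoly"
    where "s = (\<lambda>i A. taylor_sign i A * mpoly_monom (m A - m (A - {i})))"
  \<comment> \<open>\<open>z \<phi> A\<close> is the image under \<phi> of the Taylor boundary of
    the basis element of \<open>A\<close>; the chain map condition is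
    \<open>?d (\<phi> A) = z \<phi> A\<close>.\<close>
  define z where "z = (\<lambda>(\<phi> :: nat set \<Rightarrow> nat set \<Rightarrow>\<^sub>0 ('n, 'k) mpoly) A.
    \<Sum>i\<in>A. free_scale (s i A) (\<phi> (A - {i})))"
  interpret d: module_hom free_scale free_scale ?d by (rule taylor_diff_hom)
  interpret S: module "(*) :: ('n, 'k) mpoly \<Rightarrow> _" by (rule module_mpoly)
  have exact: "{f \<in> F p. ?d f = 0} = ?d ` F (p + 1)" if "p \<ge> 1" for p
    using res that unfolding free_resolution_def F_def by blast
  from res obtain \<epsilon> where \<epsilon>: "module_hom free_scale (*) \<epsilon>"
    and aug: "{f \<in> F 0. \<epsilon> f \<in> M} = ?d ` F 1"
    unfolding free_resolution_def F_def by blast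
  \<comment> \<open>As 1 is not a generator, only the empty set has label 1, so the start value of
    \<phi> lies in the resolution.\<close>
  have empty: "{} \<in> scarf_complex gs"
  proof -
    have "lcm_exp gs J \<noteq> 0" if J: "J \<subseteq> {..<length gs}" "J \<noteq> {}" for J
    proof
      assume 0: "lcm_exp gs J = 0"
      obtain j where j: "j \<in> J" using J(2) by auto
      then have "gs ! j \<preceq> 0" using nth_dvd_lcm_exp[of J j gs] J(1) 0 by (auto intro: finite_subset)
      then have "gs ! j = 0" by (intro poly_mapping_eqI) (simp add: exp_dvd_def)
      then show False using nz j J(1) nth_mem[of j gs] by auto
    qed
    then show ?thesis by (auto simp: scarf_complex_def)
  qed
  have e0: "Poly_Mapping.single {} 1 \<in> F 0" using empty by (simp add: F_def free_module_def)
  have m_mono: "m (A - B) \<preceq> m A" if "A \<subseteq> {..<N}" for A B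
    unfolding m_def using that by (intro lcm_exp_mono) (auto intro: finite_subset)
  let ?P = "\<lambda>k \<phi>. \<phi> {} = Poly_Mapping.single {} 1 \<and> (\<forall>A\<subseteq>{..<N}. card A \<le> k \<longrightarrow>
    \<phi> A \<in> F (card A) \<and> (A \<noteq> {} \<longrightarrow> ?d (\<phi> A) = z \<phi> A))"
  have "\<exists>\<phi>. ?P k \<phi>" for k
  proof (induction k)
    case 0
    show ?case using e0 by (intro exI[of _ "\<lambda>_. Poly_Mapping.single {} 1"]) (auto dest: finite_subset)
  next
    case (Suc k)
    then obtain \<phi> where \<phi>: "?P k \<phi>" by blast
    have lift: "z \<phi> A \<in> ?d ` F (Suc k)" if A: "A \<subseteq> {..<N}" "card A = Suc k" for A
    proof -
      have finA: "finite A" using A(1) finite_subset by blast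
      have \<phi>A: "\<phi> (A - {i}) \<in> F k" if "i \<in> A" for i
      proof -
        have "card (A - {i}) = k" "A - {i} \<subseteq> {..<N}" using that A by (auto simp: card_Diff_singleton)
        then show ?thesis using \<phi> by auto
      qed
      have zF: "z \<phi> A \<in> F k"
        unfolding z_def F_def using \<phi>A unfolding F_def by (intro free_module_sum free_module_scale) auto
      show ?thesis
      proof (cases "k = 0")
        \<comment> \<open>In the lowest degree the augmentation replaces the differential: the label
          of a vertex is a generator of \<open>M\<close>, so \<epsilon> sends
          \<open>z \<phi> A\<close> into \<open>M\<close>.\<close>
        case True
        then obtain i where i: "A = {i}" using A(2) card_1_singletonE by auto
        have "gs ! c i \<in> set gs" using A(1) c i by auto
        then have "mpoly_monom (m A - m (A - {i})) \<in> M"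
          unfolding M ideal_gen_def i m_def by (auto intro: S.span_base)
        then have "(taylor_sign i A * \<epsilon> (\<phi> {})) * mpoly_monom (m A - m (A - {i})) \<in> M"
          unfolding M ideal_gen_def by (rule S.span_scale)
        then have "s i A * \<epsilon> (\<phi> {}) \<in> M" by (simp only: s_def mult_ac)
        then have "\<epsilon> (z \<phi> A) \<in> M" by (simp add: z_def i module_hom.scale[OF \<epsilon>])
        then show ?thesis using zF aug True by auto
      next
        case False
        have "?d (z \<phi> A) = (\<Sum>i\<in>A. free_scale (s i A) (?d (\<phi> (A - {i}))))"
          by (simp add: z_def d.sum d.scale)
        also have "\<dots> = (\<Sum>i\<in>A. \<Sum>l\<in>A - {i}. free_scale (s i A * s l (A - {i})) (\<phi> (A - {i} - {l})))"
        proof (rule sum.cong[OF refl])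
          fix i assume i: "i \<in> A"
          then have card: "card (A - {i}) = k" and sub: "A - {i} \<subseteq> {..<N}"
            using A by (auto simp: card_Diff_singleton)
          have "A - {i} \<noteq> {}" using card False by (metis card.empty)
          with card sub have "?d (\<phi> (A - {i})) = z \<phi> (A - {i})" using \<phi> by auto
          then show "free_scale (s i A) (?d (\<phi> (A - {i})))
              = (\<Sum>l\<in>A - {i}. free_scale (s i A * s l (A - {i})) (\<phi> (A - {i} - {l})))"
            by (simp add: z_def module.scale_sum_right[OF module_free_scale]
                module.scale_scale[OF module_free_scale])
        qed
        also have "\<dots> = 0"
        proof (rule sum_antisym_pairs[OF finA])
          fix i l assume il: "i \<in> A" "l \<in> A" "i \<noteq> l"
          \<comment> \<open>Up to sign, the coefficient of two successive removals depends only on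
            the pair removed.\<close>
          have ss: "s a A * s b (A - {a})
              = of_int (incidence_sign a A * incidence_sign b (A - {a})) * mpoly_monom (m A - m (A - {a} - {b}))"
            if "a \<in> A" for a b
          proof -
            have "m (A - {a} - {b}) \<preceq> m (A - {a})" "m (A - {a}) \<preceq> m A"
              using A(1) by (auto intro!: m_mono)
            then have *: "mpoly_monom (m A - m (A - {a} - {b}))
                = (mpoly_monom (m A - m (A - {a})) * mpoly_monom (m (A - {a}) - m (A - {a} - {b})) :: ('n, 'k) mpoly)"
              by (simp add: mpoly_monom_mult exp_diff_add_diff)
            show ?thesis unfolding * by (simp only: s_def taylor_sign_eq of_int_mult mult_ac)
          qed
          have sw: "A - {l} - {i} = A - {i} - {l}" by auto
          have "s i A * s l (A - {i}) = - (s l A * s i (A - {l}))"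
            unfolding ss[OF il(1)] ss[OF il(2)] sw incidence_sign_swap[OF finA il] by simp
          then show "free_scale (s i A * s l (A - {i})) (\<phi> (A - {i} - {l}))
              = - free_scale (s l A * s i (A - {l})) (\<phi> (A - {l} - {i}))"
            unfolding sw by (simp add: module.scale_minus_left[OF module_free_scale])
        qed
        finally have "z \<phi> A \<in> {f \<in> F k. ?d f = 0}" using zF by simp
        then show ?thesis using exact[of k] False by simp
      qed
    qed
    \<comment> \<open>Lifts are chosen for sets of size \<open>Suc k\<close> only; smaller sets keep
      their values, so \<open>z\<close> is unchanged on all sets in question.\<close>
    define \<psi> where "\<psi> = (\<lambda>A. if card A = Suc k then (SOME f. f \<in> F (Suc k) \<and> ?d f = z \<phi> A) else \<phi> A)"
    have \<psi>: "\<psi> A \<in> F (Suc k) \<and> ?d (\<psi> A) = z \<phi> A" if "A \<subseteq> {..<N}" "card A = Suc k" for A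
    proof -
      have "\<exists>f. f \<in> F (Suc k) \<and> ?d f = z \<phi> A" using lift[OF that] by (metis imageE)
      from someI_ex[OF this] show ?thesis unfolding \<psi>_def using that(2) by (simp only: if_True simp_thms)
    qed
    have z: "z \<psi> A = z \<phi> A" if "A \<subseteq> {..<N}" "card A \<le> Suc k" for A
      unfolding z_def
    proof (rule sum.cong[OF refl])
      fix i assume "i \<in> A"
      then have "card (A - {i}) < card A"
        using that(1) by (intro psubset_card_mono) (auto intro: finite_subset)
      then show "free_scale (s i A) (\<psi> (A - {i})) = free_scale (s i A) (\<phi> (A - {i}))"
        using that(2) by (simp add: \<psi>_def)
    qed
    have "\<psi> A \<in> F (card A) \<and> (A \<noteq> {} \<longrightarrow> ?d (\<psi> A) = z \<psi> A)"
      if A: "A \<subseteq> {..<N}" "card A \<le> Suc k" for A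
    proof (cases "card A = Suc k")
      case True
      then show ?thesis using \<psi>[OF A(1) True] z[OF A] by simp
    next
      case False
      then have "\<psi> A = \<phi> A" "card A \<le> k" using A(2) by (auto simp: \<psi>_def)
      then show ?thesis using \<phi> A(1) z[OF A] by simp
    qed
    moreover have "\<psi> {} = Poly_Mapping.single {} 1" using \<phi> by (simp add: \<psi>_def)
    ultimately show ?case by (intro exI[of _ \<psi>]) blast
  qed
  then obtain \<phi> where \<phi>: "?P N \<phi>" by blast
  moreover have "card A \<le> N" if "A \<subseteq> {..<N}" for A
    using card_mono[OF finite_lessThan that] by simp
  ultimately have "\<phi> {} = Poly_Mapping.single {} 1 \<and>
      (\<forall>A\<subseteq>{..<N}. \<phi> A \<in> F (card A) \<and> (A \<noteq> {} \<longrightarrow> ?d (\<phi> A) = z \<phi> A))"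
    by blast
  then show ?thesis unfolding z_def s_def by blast
qed

text \<open>The form of level \<open>k\<close> on \<phi> of \<open>{..<k}\<close> has nonzero
  coefficient at the label of \<open>{..<k}\<close>. This starts with 1 at \<open>k = 0\<close> and
  persists because, in the boundary of \<open>{..<Suc k}\<close>, only the removal of
  \<open>k\<close> contributes. At \<open>k = N\<close> some face must account for the coefficient;
  its cardinality is its homological degree.\<close>

lemma scarf_resolution_full_face:
  fixes M :: "('n::finite, 'k::field) mpoly set"
  assumes res: "free_resolution (\<lambda>p. {I \<in> scarf_complex gs. card I = p}) (\<lambda>p. taylor_diff gs) M"
    and M: "M = ideal_gen (mpoly_monom ` set gs)"
    and nz: "0 \<notin> set gs"
    and c: "c ` {..<N} \<subseteq> {..<length gs}"
    and t: "\<And>A j. A \<subseteq> {..<N} \<Longrightarrow> j < length gs \<Longrightarrow> gs ! j \<preceq> lcm_exp gs (c ` A) \<Longrightarrow> t j \<in> A"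
  shows "\<exists>J\<in>scarf_complex gs. card J = N \<and> t ` J = {..<N} \<and> lcm_exp gs J \<preceq> lcm_exp gs (c ` {..<N})"
proof -
  define m where "m = (\<lambda>A. lcm_exp gs (c ` A))"
  let ?s = "\<lambda>i A. taylor_sign i A * mpoly_monom (m A - m (A - {i})) :: ('n, 'k) mpoly"
  obtain \<phi> where \<phi>0: "\<phi> {} = Poly_Mapping.single {} 1"
    and \<phi>F: "\<And>A. A \<subseteq> {..<N} \<Longrightarrow> \<phi> A \<in> free_module {I \<in> scarf_complex gs. card I = card A}"
    and d\<phi>: "\<And>A. A \<subseteq> {..<N} \<Longrightarrow> A \<noteq> {} \<Longrightarrow>
      taylor_diff gs (\<phi> A) = (\<Sum>i\<in>A. free_scale (?s i A) (\<phi> (A - {i})))"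
    using scarf_resolution_lift[OF res M nz c] unfolding m_def by blast
  let ?\<Lambda> = "pullback_form gs t"
  have sgn0: "Poly_Mapping.lookup (taylor_sign i A * q) a = 0 \<longleftrightarrow> Poly_Mapping.lookup q a = 0"
    for i A a and q :: "('n, 'k) mpoly"
    using incidence_sign_cases[of i A] by (auto simp: taylor_sign_eq)
  have m_diff: "(m A - m (A - B)) + m (A - B) = m A" if "A \<subseteq> {..<N}" for A B
    unfolding m_def using that by (intro exp_dvd_diff_add lcm_exp_mono) (auto intro: finite_subset)
  have "Poly_Mapping.lookup (?\<Lambda> k (\<phi> {..<k})) (m {..<k}) \<noteq> 0" if "k \<le> N" for k
    using that
  proof (induction k)
    case 0
    have "?\<Lambda> 0 (\<phi> {}) = (1 :: ('n, 'k) mpoly)"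
      by (simp add: \<phi>0 pullback_form_single mpoly_monom_def)
    then show ?case by (simp add: m_def)
  next
    case (Suc k)
    let ?A = "{..<Suc k}"
    have A: "?A \<subseteq> {..<N}" using Suc.prems by auto
    have keys: "Poly_Mapping.keys (\<phi> ?A) \<subseteq> Pow {..<length gs}"
      using \<phi>F[OF A] by (auto simp: free_module_def scarf_complex_def)
    \<comment> \<open>Multiplying by the quotient of two labels shifts the coefficient in question
      to the smaller label; the sign is a unit.\<close>
    have summand: "Poly_Mapping.lookup (?s i ?A * ?\<Lambda> k (\<phi> (?A - {i}))) (m ?A) = 0 \<longleftrightarrow>
        Poly_Mapping.lookup (?\<Lambda> k (\<phi> (?A - {i}))) (m (?A - {i})) = 0" for i
      using lookup_monom_mult[of "m ?A - m (?A - {i})" "?\<Lambda> k (\<phi> (?A - {i}))" "m (?A - {i})"]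
      by (simp add: mult.assoc sgn0 m_diff[OF A])
    \<comment> \<open>A face that contributes after the removal of \<open>i < k\<close> would need a
      vertex over \<open>i\<close> and a label dividing that of \<open>?A - {i}\<close>, which the
      condition on \<open>t\<close> excludes.\<close>
    have zero: "Poly_Mapping.lookup (?s i ?A * ?\<Lambda> k (\<phi> (?A - {i}))) (m ?A) = 0" if "i < k" for i
    proof -
      have "Poly_Mapping.lookup (of_int (pullback_cochain t k J) * mpoly_monom (lcm_exp gs J)
          * Poly_Mapping.lookup (\<phi> (?A - {i})) J) (m (?A - {i})) = 0" if J: "J \<subseteq> {..<length gs}" for J
      proof (cases "lcm_exp gs J \<preceq> m (?A - {i})")
        case True
        have "i \<notin> t ` J"
        proof
          assume "i \<in> t ` J"
          then obtain j where j: "j \<in> J" "t j = i" by auto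
          have "gs ! j \<preceq> lcm_exp gs J" using j J by (intro nth_dvd_lcm_exp) (auto intro: finite_subset)
          then have "gs ! j \<preceq> m (?A - {i})" using True exp_dvd_trans by blast
          moreover have "?A - {i} \<subseteq> {..<N}" "j < length gs" using A j J by auto
          ultimately have "t j \<in> ?A - {i}" unfolding m_def by (intro t)
          then show False using j by simp
        qed
        then have "pullback_cochain t k J = 0" using pullback_cochain_nonzero_imp \<open>i < k\<close> by blast
        then show ?thesis by simp
      next
        case False
        then show ?thesis by (rule lookup_coeff_monom_mult_eq_0)
      qed
      then have "Poly_Mapping.lookup (?\<Lambda> k (\<phi> (?A - {i}))) (m (?A - {i})) = 0"
        unfolding pullback_form_def lookup_sum by (intro sum.neutral) blast
      then show ?thesis by (simp only: summand)
    qed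
    have "Poly_Mapping.lookup (?\<Lambda> (Suc k) (\<phi> ?A)) (m ?A)
        = Poly_Mapping.lookup (?\<Lambda> k (taylor_diff gs (\<phi> ?A))) (m ?A)"
      using t[OF A] by (intro lookup_pullback_form_taylor_diff[symmetric] keys) (auto simp: m_def less_Suc_eq_le)
    also have "taylor_diff gs (\<phi> ?A) = (\<Sum>i\<in>?A. free_scale (?s i ?A) (\<phi> (?A - {i})))"
      by (rule d\<phi>[OF A]) auto
    also have "Poly_Mapping.lookup (?\<Lambda> k \<dots>) (m ?A)
        = (\<Sum>i\<in>?A. Poly_Mapping.lookup (?s i ?A * ?\<Lambda> k (\<phi> (?A - {i}))) (m ?A))"
      by (simp only: pullback_form_sum pullback_form_scale lookup_sum)
    also have "\<dots> = Poly_Mapping.lookup (?s k ?A * ?\<Lambda> k (\<phi> (?A - {k}))) (m ?A)"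
      using zero by (simp add: lessThan_Suc)
    finally have "Poly_Mapping.lookup (?\<Lambda> (Suc k) (\<phi> ?A)) (m ?A) = 0 \<longleftrightarrow>
        Poly_Mapping.lookup (?\<Lambda> k (\<phi> (?A - {k}))) (m (?A - {k})) = 0"
      by (simp only: summand)
    moreover have "?A - {k} = {..<k}" by auto
    ultimately show ?case using Suc by simp
  qed
  from this[of N] obtain J where J: "J \<subseteq> {..<length gs}"
    and ne: "Poly_Mapping.lookup (of_int (pullback_cochain t N J) * mpoly_monom (lcm_exp gs J)
        * Poly_Mapping.lookup (\<phi> {..<N}) J) (m {..<N}) \<noteq> 0"
    unfolding pullback_form_def lookup_sum by (auto elim!: sum.not_neutral_contains_not_neutral)
  have dvd: "lcm_exp gs J \<preceq> m {..<N}"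
    using ne lookup_coeff_monom_mult_eq_0 by blast
  have "J \<in> Poly_Mapping.keys (\<phi> {..<N})" using ne by (auto simp: in_keys_iff)
  then have "J \<in> scarf_complex gs" "card J = N" using \<phi>F[of "{..<N}"] by (auto simp: free_module_def)
  moreover have "t ` J = {..<N}"
  proof
    show "t ` J \<subseteq> {..<N}"
    proof
      fix i assume "i \<in> t ` J"
      then obtain j where j: "j \<in> J" "i = t j" by auto
      then have "gs ! j \<preceq> m {..<N}"
        using nth_dvd_lcm_exp[of J j gs] J dvd exp_dvd_trans by (blast intro: finite_subset)
      then show "i \<in> {..<N}" using t[of "{..<N}" j] j J unfolding m_def by blast
    qed
    have "pullback_cochain t N J \<noteq> 0" using ne by auto
    then show "{..<N} \<subseteq> t ` J" using pullback_cochain_nonzero_imp by blast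
  qed
  ultimately show ?thesis using dvd unfolding m_def by blast
qed


text \<open>The first condition on \<open>\<tau>\<close> says that \<open>w\<close> divides the lcm of the \<open>y i\<close> with \<open>i \<in> A\<close> only if
  \<open>\<tau> w \<in> A\<close>; the second that \<open>J\<close> and \<open>W\<close> have the same lcm, so that \<open>J\<close> is not a Scarf face.\<close>

definition scarf_obstruction :: "'n expvec set \<Rightarrow> bool" where
  "scarf_obstruction W \<longleftrightarrow> (\<exists>N y \<tau>. y ` {..<N :: nat} \<subseteq> W \<and>
     (\<forall>A\<subseteq>{..<N}. \<forall>w\<in>W. (\<forall>v. Poly_Mapping.lookup w v = 0 \<or>
        (\<exists>i\<in>A. Poly_Mapping.lookup w v \<le> Poly_Mapping.lookup (y i) v)) \<longrightarrow> \<tau> w \<in> A) \<and>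
     (\<forall>J\<subseteq>W. bij_betw \<tau> J {..<N} \<longrightarrow>
        J \<noteq> W \<and> (\<forall>w\<in>W. \<forall>v. \<exists>u\<in>J. Poly_Mapping.lookup w v \<le> Poly_Mapping.lookup u v)))"

text \<open>The full face \<open>J\<close> obtained from the resolution consists of generators
  dividing \<open>b\<close> and is mapped bijectively by \<tau>. By the obstruction,
  \<open>J\<close> differs from the set \<open>?V\<close> of all indices of generators dividing
  \<open>b\<close> but has the same lcm, so it is not a Scarf face.\<close>

lemma not_scarf_if_obstruction:
  assumes G: "G \<subseteq> monomials_of_degree D" and D: "D > 0"
    and W: "scarf_obstruction {g \<in> G. g \<preceq> b}"
  shows "\<not> is_scarf (ideal_gen (mpoly_monom ` G) :: ('n::finite, 'k::field) mpoly set)"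
proof
  let ?M = "ideal_gen (mpoly_monom ` G) :: ('n, 'k) mpoly set" and ?W = "{g \<in> G. g \<preceq> b}"
  assume "is_scarf ?M"
  then obtain gs where gs: "distinct gs" "minimal_generators (set gs) ?M"
    and res: "free_resolution (\<lambda>p. {I \<in> scarf_complex gs. card I = p}) (\<lambda>p. taylor_diff gs) ?M"
    unfolding is_scarf_def minimal_free_resolution_def by blast
  have set: "set gs = G" using minimal_generators_unique[OF gs(2) G] .
  from W obtain N :: nat and y \<tau> where y: "y ` {..<N} \<subseteq> ?W"
    and \<tau>: "\<forall>A\<subseteq>{..<N}. \<forall>w\<in>?W. (\<forall>v. Poly_Mapping.lookup w v = 0 \<or>
        (\<exists>i\<in>A. Poly_Mapping.lookup w v \<le> Poly_Mapping.lookup (y i) v)) \<longrightarrow> \<tau> w \<in> A"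
    and bij: "\<forall>J\<subseteq>?W. bij_betw \<tau> J {..<N} \<longrightarrow>
        J \<noteq> ?W \<and> (\<forall>w\<in>?W. \<forall>v. \<exists>u\<in>J. Poly_Mapping.lookup w v \<le> Poly_Mapping.lookup u v)"
    unfolding scarf_obstruction_def by (elim exE conjE) (rule that; assumption)
  have "\<exists>j<length gs. gs ! j = y i" if "i < N" for i
    using y that set by (auto simp flip: in_set_conv_nth)
  then obtain c where c: "\<And>i. i < N \<Longrightarrow> c i < length gs \<and> gs ! c i = y i" by metis
  have lcm_b: "lcm_exp gs (c ` A) \<preceq> b" if "A \<subseteq> {..<N}" for A
    using that c y by (intro lcm_exp_dvd) (auto intro: finite_subset)
  have t: "\<tau> (gs ! j) \<in> A"
    if A: "A \<subseteq> {..<N}" and j: "j < length gs" and le: "gs ! j \<preceq> lcm_exp gs (c ` A)" for A j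
  proof (rule \<tau>[rule_format, OF A])
    show "gs ! j \<in> ?W" using lcm_b[OF A] le exp_dvd_trans j set by auto
    fix v
    have "finite A" using A finite_subset by blast
    \<comment> \<open>The maximum is attained by a chosen generator or is the inserted 0; the second
      case is why the obstruction allows the exponent 0 separately.\<close>
    then have "Poly_Mapping.lookup (lcm_exp gs (c ` A)) v
        \<in> insert 0 ((\<lambda>i. Poly_Mapping.lookup (gs ! i) v) ` c ` A)"
      unfolding lookup_lcm_exp by (intro Max_in) auto
    moreover have "Poly_Mapping.lookup (gs ! j) v \<le> Poly_Mapping.lookup (lcm_exp gs (c ` A)) v"
      using le by (simp add: exp_dvd_def)
    ultimately show "Poly_Mapping.lookup (gs ! j) v = 0 \<or>
        (\<exists>i\<in>A. Poly_Mapping.lookup (gs ! j) v \<le> Poly_Mapping.lookup (y i) v)"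
      using A c by fastforce
  qed
  have "0 \<notin> set gs" using G D set by (auto simp: monomials_of_degree_def total_degree_def)
  then obtain J where J: "J \<in> scarf_complex gs" "card J = N" "(\<lambda>j. \<tau> (gs ! j)) ` J = {..<N}"
    "lcm_exp gs J \<preceq> lcm_exp gs (c ` {..<N})"
    using scarf_resolution_full_face[OF res, of c N "\<lambda>j. \<tau> (gs ! j)"] c t set by blast
  let ?V = "{j. j < length gs \<and> gs ! j \<in> ?W}"
  have Jlen: "J \<subseteq> {..<length gs}" and finJ: "finite J"
    using J(1) by (auto simp: scarf_complex_def intro: finite_subset)
  have JV: "J \<subseteq> ?V"
  proof
    fix j assume j: "j \<in> J"
    then have "gs ! j \<preceq> lcm_exp gs J" by (intro nth_dvd_lcm_exp finJ)
    then have "gs ! j \<preceq> b" using J(4) lcm_b[of "{..<N}"] exp_dvd_trans by blast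
    then show "j \<in> ?V" using j Jlen set by auto
  qed
  let ?J = "(!) gs ` J"
  \<comment> \<open>\<open>J\<close> has \<open>N\<close> elements and an image of size
    \<open>N\<close>, which forces \<tau> to be injective on the generators of
    \<open>J\<close>.\<close>
  have "card (\<tau> ` ?J) = N" using J(3) by (simp add: image_image)
  moreover have "card (\<tau> ` ?J) \<le> card ?J" "card ?J \<le> card J"
    using finJ by (auto intro: card_image_le)
  ultimately have "card (\<tau> ` ?J) = card ?J" using J(2) by simp
  then have "inj_on \<tau> ?J" using finJ by (intro eq_card_imp_inj_on) auto
  then have "bij_betw \<tau> ?J {..<N}" using J(3) by (simp add: bij_betw_def image_image)
  moreover have "?J \<subseteq> ?W" using JV by auto
  ultimately have J': "?J \<noteq> ?W \<and>
      (\<forall>w\<in>?W. \<forall>v. \<exists>u\<in>?J. Poly_Mapping.lookup w v \<le> Poly_Mapping.lookup u v)"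
    by (intro bij[rule_format])
  then have neq: "?J \<noteq> ?W"
    and cover: "\<And>w v. w \<in> ?W \<Longrightarrow> \<exists>u\<in>?J. Poly_Mapping.lookup w v \<le> Poly_Mapping.lookup u v"
    by blast+
  have "(!) gs ` ?V = ?W" by (fastforce simp: image_iff in_set_conv_nth simp flip: set)
  then have "?V \<noteq> J" using neq by metis
  moreover have "lcm_exp gs ?V = lcm_exp gs J"
  proof (rule exp_dvd_antisym)
    show "lcm_exp gs J \<preceq> lcm_exp gs ?V" using JV by (intro lcm_exp_mono) auto
    show "lcm_exp gs ?V \<preceq> lcm_exp gs J"
    proof (rule lcm_exp_dvd)
      fix j assume "j \<in> ?V"
      then have j: "gs ! j \<in> ?W" by simp
      show "gs ! j \<preceq> lcm_exp gs J"
        unfolding exp_dvd_def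
      proof
        fix v
        obtain i where "i \<in> J" "Poly_Mapping.lookup (gs ! j) v \<le> Poly_Mapping.lookup (gs ! i) v"
          using cover[OF j, of v] by auto
        moreover from this have "gs ! i \<preceq> lcm_exp gs J" by (intro nth_dvd_lcm_exp finJ)
        ultimately show "Poly_Mapping.lookup (gs ! j) v \<le> Poly_Mapping.lookup (lcm_exp gs J) v"
          unfolding exp_dvd_def by (meson order_trans)
      qed
    qed auto
  qed
  moreover have "?V \<subseteq> {..<length gs}" by auto
  ultimately show False using J(1) unfolding scarf_complex_def by blast
qed

subsection \<open>Random subsets and independent blocks\<close>

text \<open>The law of \<open>random_generators\<close> on an arbitrary ground set.\<close>

definition random_subset :: "'a set \<Rightarrow> real \<Rightarrow> 'a set pmf" where
  "random_subset U p = map_pmf (\<lambda>X. {a \<in> U. X a}) (Pi_pmf U False (\<lambda>_. bernoulli_pmf p))"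

definition subset_weight :: "real \<Rightarrow> 'a set \<Rightarrow> 'a set \<Rightarrow> real" where
  "subset_weight p B W = p ^ card W * (1 - p) ^ card (B - W)"

lemma prob_random_subset_Int_eq:
  assumes "finite U" "W \<subseteq> B" "B \<subseteq> U" and p: "0 \<le> p" "p \<le> 1"
  shows "measure_pmf.prob (random_subset U p) {G. G \<inter> B = W} = subset_weight p B W"
proof -
  \<comment> \<open>The event constrains each point separately: present on \<open>W\<close>, absent
    on the rest of \<open>B\<close>, free elsewhere.\<close>
  let ?S = "\<lambda>a. if a \<in> W then {True} else if a \<in> B then {False} else UNIV"
  have fin: "finite B" "finite W" using assms(1-3) by (auto intro: finite_subset)
  have "(\<lambda>X. {a \<in> U. X a}) -` {G. G \<inter> B = W} = Pi U ?S"
  proof (intro set_eqI)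
    fix X :: "'a \<Rightarrow> bool"
    have "{a \<in> U. X a} \<inter> B = W \<longleftrightarrow> (\<forall>a\<in>U. X a \<in> ?S a)"
      using assms(2,3) by (auto split: if_splits)
    then show "X \<in> (\<lambda>X. {a \<in> U. X a}) -` {G. G \<inter> B = W} \<longleftrightarrow> X \<in> Pi U ?S"
      by (simp only: vimage_eq mem_Collect_eq Pi_iff)
  qed
  then have "measure_pmf.prob (random_subset U p) {G. G \<inter> B = W}
      = (\<Prod>a\<in>U. measure_pmf.prob (bernoulli_pmf p) (?S a))"
    unfolding random_subset_def measure_map_pmf using assms(1) by (simp add: measure_Pi_pmf_Pi)
  also have "\<dots> = (\<Prod>a\<in>U. if a \<in> W then p else if a \<in> B then 1 - p else 1)"
    using p by (intro prod.cong) (auto simp: measure_pmf_single)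
  also have "\<dots> = (\<Prod>a\<in>B. if a \<in> W then p else 1 - p)"
    using assms(1-3) by (intro prod.mono_neutral_cong_right) auto
  also have "\<dots> = (\<Prod>a\<in>W. p) * (\<Prod>a\<in>B - W. 1 - p)"
    using assms(2) fin by (subst prod.subset_diff[of W B]) auto
  finally show ?thesis by (simp add: subset_weight_def)
qed

lemma prob_random_subset_Int_in:
  assumes "finite U" "\<W> \<subseteq> Pow B" "B \<subseteq> U" "0 \<le> p" "p \<le> 1"
  shows "measure_pmf.prob (random_subset U p) {G. G \<inter> B \<in> \<W>} = (\<Sum>W\<in>\<W>. subset_weight p B W)"
proof -
  have "finite \<W>" using assms(1-3) by (meson finite_Pow_iff finite_subset)
  then have "measure_pmf.prob (random_subset U p) (\<Union>W\<in>\<W>. {G. G \<inter> B = W})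
      = (\<Sum>W\<in>\<W>. measure_pmf.prob (random_subset U p) {G. G \<inter> B = W})"
    by (intro measure_pmf.finite_measure_finite_Union) (auto simp: disjoint_family_on_def)
  moreover have "(\<Union>W\<in>\<W>. {G. G \<inter> B = W}) = {G. G \<inter> B \<in> \<W>}" by auto
  ultimately show ?thesis
    using assms by (simp add: prob_random_subset_Int_eq subset_iff cong: sum.cong)
qed

lemma subset_weight_disjoint_Un:
  assumes "finite A" "finite B" "A \<inter> B = {}" "V \<subseteq> A" "W \<subseteq> B"
  shows "subset_weight p (A \<union> B) (V \<union> W) = subset_weight p A V * subset_weight p B W"
proof -
  have fin: "finite V" "finite W" using assms by (auto intro: finite_subset)
  have "(A \<union> B) - (V \<union> W) = (A - V) \<union> (B - W)" using assms by auto
  moreover have "card ((A - V) \<union> (B - W)) = card (A - V) + card (B - W)"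
    using assms by (intro card_Un_disjoint) auto
  moreover have "card (V \<union> W) = card V + card W"
    using assms fin by (intro card_Un_disjoint) auto
  ultimately show ?thesis by (simp add: subset_weight_def power_add)
qed

text \<open>A trace on \<open>A \<union> B\<close> splits uniquely into traces on the disjoint
  parts, and its weight is the product of theirs; summing over both families factorizes the
  probability.\<close>

lemma prob_random_subset_indep:
  assumes U: "finite U" "A \<subseteq> U" "B \<subseteq> U" and disj: "A \<inter> B = {}"
    and fam: "\<A> \<subseteq> Pow A" "\<B> \<subseteq> Pow B" and p: "0 \<le> p" "p \<le> 1"
  shows "measure_pmf.prob (random_subset U p) {G. G \<inter> A \<in> \<A> \<and> G \<inter> B \<in> \<B>}
    = measure_pmf.prob (random_subset U p) {G. G \<inter> A \<in> \<A>}
      * measure_pmf.prob (random_subset U p) {G. G \<inter> B \<in> \<B>}"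
proof -
  have fin: "finite A" "finite B" using U by (auto intro: finite_subset)
  let ?u = "\<lambda>(V, W). V \<union> W"
  have inj: "inj_on ?u (\<A> \<times> \<B>)"
  proof (rule inj_onI, clarify)
    fix V W V' W' assume "V \<in> \<A>" "W \<in> \<B>" "V' \<in> \<A>" "W' \<in> \<B>" "V \<union> W = V' \<union> W'"
    then have "V = (V' \<union> W') \<inter> A" "V' = (V' \<union> W') \<inter> A" "W = (V' \<union> W') \<inter> B" "W' = (V' \<union> W') \<inter> B"
      using fam disj by blast+
    then show "V = V' \<and> W = W'" by metis
  qed
  have "{G. G \<inter> A \<in> \<A> \<and> G \<inter> B \<in> \<B>} = {G. G \<inter> (A \<union> B) \<in> ?u ` (\<A> \<times> \<B>)}"
  proof (intro Collect_cong iffI)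
    fix G assume "G \<inter> A \<in> \<A> \<and> G \<inter> B \<in> \<B>"
    then show "G \<inter> (A \<union> B) \<in> ?u ` (\<A> \<times> \<B>)"
      by (intro image_eqI[where x = "(G \<inter> A, G \<inter> B)"]) (auto simp: Int_Un_distrib)
  next
    fix G assume "G \<inter> (A \<union> B) \<in> ?u ` (\<A> \<times> \<B>)"
    then obtain V W where VW: "V \<in> \<A>" "W \<in> \<B>" "G \<inter> (A \<union> B) = V \<union> W" by auto
    then have "G \<inter> A = V" "G \<inter> B = W" using fam disj by blast+
    then show "G \<inter> A \<in> \<A> \<and> G \<inter> B \<in> \<B>" using VW by simp
  qed
  moreover have "?u ` (\<A> \<times> \<B>) \<subseteq> Pow (A \<union> B)" using fam by auto
  ultimately have "measure_pmf.prob (random_subset U p) {G. G \<inter> A \<in> \<A> \<and> G \<inter> B \<in> \<B>}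
      = (\<Sum>W\<in>?u ` (\<A> \<times> \<B>). subset_weight p (A \<union> B) W)"
    using U p by (simp add: prob_random_subset_Int_in)
  also have "\<dots> = (\<Sum>(V, W)\<in>\<A> \<times> \<B>. subset_weight p A V * subset_weight p B W)"
    unfolding sum.reindex[OF inj]
    using fam disj fin by (intro sum.cong refl) (auto intro!: subset_weight_disjoint_Un)
  also have "\<dots> = (\<Sum>V\<in>\<A>. subset_weight p A V) * (\<Sum>W\<in>\<B>. subset_weight p B W)"
    by (simp add: sum_product sum.cartesian_product)
  finally show ?thesis using U fam p by (simp add: prob_random_subset_Int_in)
qed

text \<open>Induction on \<open>I\<close>: avoiding the earlier families depends only on the trace
  on the union of the earlier blocks, which is disjoint from the new block, so each block
  contributes a factor of at most \<open>1 - q\<close>.\<close>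

lemma prob_random_subset_avoid_blocks:
  assumes U: "finite U" and p: "0 \<le> p" "p \<le> 1" and I: "finite I"
    and B: "\<And>i. i \<in> I \<Longrightarrow> B i \<subseteq> U" and disj: "disjoint_family_on B I"
    and \<W>: "\<And>i. i \<in> I \<Longrightarrow> \<W> i \<subseteq> Pow (B i)"
    and q: "\<And>i. i \<in> I \<Longrightarrow> q \<le> measure_pmf.prob (random_subset U p) {G. G \<inter> B i \<in> \<W> i}"
    and q1: "q \<le> 1"
  shows "measure_pmf.prob (random_subset U p) {G. \<forall>i\<in>I. G \<inter> B i \<notin> \<W> i} \<le> (1 - q) ^ card I"
  using I B disj \<W> q
proof (induction I rule: finite_induct)
  case (insert j I)
  let ?P = "measure_pmf.prob (random_subset U p)"
  let ?A = "\<Union>i\<in>I. B i" and ?\<A> = "{W \<in> Pow (\<Union>i\<in>I. B i). \<forall>i\<in>I. W \<inter> B i \<notin> \<W> i}"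
  have res: "G \<inter> ?A \<inter> B i = G \<inter> B i" if "i \<in> I" for G i using that by auto
  have A: "{G. G \<inter> ?A \<in> ?\<A>} = {G. \<forall>i\<in>I. G \<inter> B i \<notin> \<W> i}"
    using res by auto
  have Bj: "{G. G \<inter> B j \<in> Pow (B j) - \<W> j} = UNIV - {G. G \<inter> B j \<in> \<W> j}" by auto
  have "{G. \<forall>i\<in>insert j I. G \<inter> B i \<notin> \<W> i}
      = {G. \<forall>i\<in>I. G \<inter> B i \<notin> \<W> i} \<inter> (UNIV - {G. G \<inter> B j \<in> \<W> j})"
    by auto
  also have "\<dots> = {G. G \<inter> ?A \<in> ?\<A> \<and> G \<inter> B j \<in> Pow (B j) - \<W> j}"
    unfolding A[symmetric] Bj[symmetric] by (rule Collect_conj_eq[symmetric])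
  finally have split: "{G. \<forall>i\<in>insert j I. G \<inter> B i \<notin> \<W> i} = \<dots>" .
  have indep: "?P {G. G \<inter> ?A \<in> ?\<A> \<and> G \<inter> B j \<in> Pow (B j) - \<W> j}
      = ?P {G. G \<inter> ?A \<in> ?\<A>} * ?P {G. G \<inter> B j \<in> Pow (B j) - \<W> j}"
  proof (rule prob_random_subset_indep[OF U _ _ _ _ _ p])
    have "B i \<inter> B j = {}" if "i \<in> I" for i
      using that insert.hyps(2) by (intro disjoint_family_onD[OF insert.prems(2)]) auto
    then show "?A \<inter> B j = {}" by auto
    show "?A \<subseteq> U" "B j \<subseteq> U" using insert.prems(1) by blast+
    show "?\<A> \<subseteq> Pow ?A" "Pow (B j) - \<W> j \<subseteq> Pow (B j)" by blast+
  qed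
  have compl: "?P (UNIV - {G. G \<inter> B j \<in> \<W> j}) = 1 - ?P {G. G \<inter> B j \<in> \<W> j}"
    using measure_pmf.prob_compl[of "{G. G \<inter> B j \<in> \<W> j}" "random_subset U p"] by simp
  have "?P {G. \<forall>i\<in>I. G \<inter> B i \<notin> \<W> i} \<le> (1 - q) ^ card I"
  proof (rule insert.IH)
    show "disjoint_family_on B I"
      using insert.prems(2) by (rule disjoint_family_on_mono[rotated]) auto
  qed (use insert.prems in blast)+
  moreover have "1 - ?P {G. G \<inter> B j \<in> \<W> j} \<le> 1 - q" using insert.prems(4)[of j] by simp
  ultimately have "?P {G. \<forall>i\<in>I. G \<inter> B i \<notin> \<W> i} * (1 - ?P {G. G \<inter> B j \<in> \<W> j})
      \<le> (1 - q) ^ card I * (1 - q)"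
    using q1 by (intro mult_mono) auto
  then show ?case
    unfolding split indep A Bj compl using insert.hyps by (simp add: mult.commute)
qed simp

subsection \<open>Blocks of monomials below a corner\<close>

text \<open>A block consists of the monomials of degree \<open>D\<close> dividing a corner of degree \<open>D + S\<close>; its
  elements are described by the exponents \<open>s\<close> of the cofactor, which have sum \<open>S\<close>.\<close>

definition cofactors :: "nat \<Rightarrow> ('n::finite \<Rightarrow> nat) set" where
  "cofactors S = {s. sum s UNIV = S}"

definition codivisor :: "'n::finite expvec \<Rightarrow> ('n \<Rightarrow> nat) \<Rightarrow> 'n expvec" where
  "codivisor c s = Abs_poly_mapping (\<lambda>v. Poly_Mapping.lookup c v - s v)"

definition block :: "nat \<Rightarrow> 'n::finite expvec \<Rightarrow> 'n expvec set" where
  "block D c = {a \<in> monomials_of_degree D. a \<preceq> c}"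

lemma lookup_codivisor [simp]: "Poly_Mapping.lookup (codivisor c s) v = Poly_Mapping.lookup c v - s v"
  by (simp add: codivisor_def)

lemma cofactor_le: "s \<in> cofactors S \<Longrightarrow> s v \<le> S"
  unfolding cofactors_def using member_le_sum[of v UNIV s] by auto

text \<open>Entries of a cofactor are at most \<open>S\<close>, so the lower bound on
  \<open>c\<close> keeps the subtraction of natural numbers from truncating.\<close>

lemma inj_on_codivisor:
  assumes "\<And>v. S \<le> Poly_Mapping.lookup c v"
  shows "inj_on (codivisor c) (cofactors S)"
proof (rule inj_onI, rule ext)
  fix s t v assume st: "s \<in> cofactors S" "t \<in> cofactors S" "codivisor c s = codivisor c t"
  then have "Poly_Mapping.lookup c v - s v = Poly_Mapping.lookup c v - t v"
    by (metis lookup_codivisor)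
  then show "s v = t v" using cofactor_le[OF st(1), of v] cofactor_le[OF st(2), of v] assms[of v] by linarith
qed

lemma block_eq_codivisors:
  assumes c: "\<And>v. S \<le> Poly_Mapping.lookup c v" and deg: "total_degree c = D + S"
  shows "block D c = codivisor c ` cofactors S"
proof
  show "codivisor c ` cofactors S \<subseteq> block D c"
  proof
    fix a assume "a \<in> codivisor c ` cofactors S"
    then obtain s where s: "s \<in> cofactors S" "a = codivisor c s" by auto
    have "total_degree a + S = total_degree c"
      unfolding total_degree_def using s cofactor_le[OF s(1)] c
      by (auto simp: cofactors_def simp flip: sum.distrib intro!: sum.cong) (meson le_add_diff_inverse2 order_trans)
    then show "a \<in> block D c"
      using deg s(2) by (auto simp: block_def monomials_of_degree_def exp_dvd_def)
  qed
  show "block D c \<subseteq> codivisor c ` cofactors S"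
  proof
    fix a assume "a \<in> block D c"
    then have a: "total_degree a = D" "\<And>v. Poly_Mapping.lookup a v \<le> Poly_Mapping.lookup c v"
      by (auto simp: block_def monomials_of_degree_def exp_dvd_def)
    let ?s = "\<lambda>v. Poly_Mapping.lookup c v - Poly_Mapping.lookup a v"
    have "sum ?s UNIV = S"
      using a deg by (subst sum_subtractf_nat) (auto simp: total_degree_def)
    moreover have "a = codivisor c ?s" using a(2) by (intro poly_mapping_eqI) simp
    ultimately show "a \<in> codivisor c ` cofactors S" unfolding cofactors_def by blast
  qed
qed

text \<open>The prescribed sum determines the entry at \<open>u\<close>; this is why blocks have
  dimension \<open>CARD('n) - 1\<close>.\<close>

lemma cofactors_inj_restrict: "inj_on (\<lambda>s. restrict s (UNIV - {u})) (cofactors S :: ('n::finite \<Rightarrow> nat) set)"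
proof (rule inj_onI, rule ext)
  fix s t :: "'n \<Rightarrow> nat" and v
  assume st: "s \<in> cofactors S" "t \<in> cofactors S" "restrict s (UNIV - {u}) = restrict t (UNIV - {u})"
  have eq: "s w = t w" if "w \<noteq> u" for w using fun_cong[OF st(3), of w] that by simp
  have "s u + sum s (UNIV - {u}) = t u + sum t (UNIV - {u})"
    using st(1,2) by (simp add: cofactors_def flip: sum.remove)
  moreover have "sum s (UNIV - {u}) = sum t (UNIV - {u})" using eq by (intro sum.cong) auto
  ultimately show "s v = t v" using eq by (cases "v = u") auto
qed

lemma cofactors_restrict_image:
  "(\<lambda>s. restrict s (UNIV - {u})) ` cofactors S \<subseteq> PiE (UNIV - {u}) (\<lambda>_. {..S})"
  by (auto simp: cofactor_le restrict_PiE_iff image_subset_iff)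

lemma finite_cofactors [simp]: "finite (cofactors S)"
  using finite_imageD[OF finite_subset[OF cofactors_restrict_image finite_PiE] cofactors_inj_restrict]
  by simp

lemma card_cofactors_le: "card (cofactors S :: ('n::finite \<Rightarrow> nat) set) \<le> (S + 1) ^ (CARD('n) - 1)"
proof -
  fix u :: 'n
  have "card (cofactors S :: ('n \<Rightarrow> nat) set) \<le> card (PiE (UNIV - {u}) (\<lambda>_. {..S}))"
    by (rule card_inj_on_le[OF cofactors_inj_restrict cofactors_restrict_image finite_PiE]) auto
  then show ?thesis by (simp add: card_PiE card_Diff_singleton)
qed

lemma block_subset: "block D c \<subseteq> monomials_of_degree D"
  by (auto simp: block_def)

text \<open>A member of a block lies within \<open>S\<close> of its corner in every coordinate, so a
  common member would bring the corners within \<open>S\<close> of each other at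
  \<open>v\<close>.\<close>

lemma blocks_disjoint:
  assumes deg: "total_degree c = D + S" "total_degree c' = D + S"
    and far: "Poly_Mapping.lookup c v + S < Poly_Mapping.lookup c' v"
  shows "block D c \<inter> block D c' = {}"
proof (rule ccontr)
  assume "\<not> ?thesis"
  then obtain a where a: "total_degree a = D" "a \<preceq> c" "a \<preceq> c'"
    by (auto simp: block_def monomials_of_degree_def)
  have "(\<Sum>w\<in>UNIV. Poly_Mapping.lookup c' w - Poly_Mapping.lookup a w) = S"
    using a deg by (subst sum_subtractf_nat) (auto simp: total_degree_def exp_dvd_def)
  then have "Poly_Mapping.lookup c' v - Poly_Mapping.lookup a v \<le> S"
    using member_le_sum[of v UNIV "\<lambda>w. Poly_Mapping.lookup c' w - Poly_Mapping.lookup a w"] by simp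
  moreover have "Poly_Mapping.lookup a v \<le> Poly_Mapping.lookup c v" using a(2) by (simp add: exp_dvd_def)
  ultimately show False using far by linarith
qed

text \<open>Corners are placed on a grid of mesh \<open>S + 1\<close> in all coordinates but \<open>v\<^sub>0\<close>, the last exponent
  being determined by the degree.\<close>

lemma disjoint_blocks_exist:
  fixes D S R :: nat
  assumes R: "(CARD('n) - 1) * (S + 1) * R < D"
  obtains c :: "('n::finite \<Rightarrow> nat) \<Rightarrow> 'n expvec" and I :: "('n \<Rightarrow> nat) set"
  where "finite I" "card I = R ^ (CARD('n) - 1)"
    "\<And>i. i \<in> I \<Longrightarrow> total_degree (c i) = D + S"
    "\<And>i v. i \<in> I \<Longrightarrow> S < Poly_Mapping.lookup (c i) v"
    "disjoint_family_on (\<lambda>i. block D (c i)) I"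
proof -
  fix v0 :: 'n
  let ?V = "UNIV - {v0}"
  define I where "I = PiE ?V (\<lambda>_. {..<R})"
  \<comment> \<open>The 1 in \<open>1 + u v\<close> keeps the grid exponents above \<open>S\<close>.
    The bound \<open>sum_less\<close> prevents truncation at \<open>v0\<close> and leaves more than
    \<open>S\<close> there.\<close>
  define c where "c = (\<lambda>u :: 'n \<Rightarrow> nat. Abs_poly_mapping (\<lambda>v. if v = v0
    then D + S - (\<Sum>w\<in>?V. (S + 1) * (1 + u w)) else (S + 1) * (1 + u v)))"
  have c: "Poly_Mapping.lookup (c u) v = (if v = v0
    then D + S - (\<Sum>w\<in>?V. (S + 1) * (1 + u w)) else (S + 1) * (1 + u v))" for u v
    by (simp add: c_def)
  have sum_less: "(\<Sum>w\<in>?V. (S + 1) * (1 + u w)) < D" if "u \<in> I" for u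
  proof -
    have "(\<Sum>w\<in>?V. (S + 1) * (1 + u w)) \<le> (\<Sum>w\<in>?V. (S + 1) * R)"
      using that by (intro sum_mono mult_left_mono) (auto simp: I_def PiE_iff Suc_le_eq)
    also have "\<dots> = card ?V * ((S + 1) * R)" by (simp only: sum_constant of_nat_id)
    also have "card ?V = CARD('n) - 1" by (simp add: card_Diff_singleton)
    finally show ?thesis using R by (simp only: mult.assoc)
  qed
  have deg: "total_degree (c u) = D + S" if "u \<in> I" for u
  proof -
    have "total_degree (c u) = Poly_Mapping.lookup (c u) v0 + (\<Sum>v\<in>?V. Poly_Mapping.lookup (c u) v)"
      unfolding total_degree_def by (rule sum.remove) auto
    also have "(\<Sum>v\<in>?V. Poly_Mapping.lookup (c u) v) = (\<Sum>w\<in>?V. (S + 1) * (1 + u w))"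
      by (rule sum.cong) (auto simp: c)
    finally show ?thesis using sum_less[OF that] unfolding c by simp
  qed
  have far: "\<exists>v. Poly_Mapping.lookup (c u) v + S < Poly_Mapping.lookup (c u') v \<or>
      Poly_Mapping.lookup (c u') v + S < Poly_Mapping.lookup (c u) v"
    if u: "u \<in> I" "u' \<in> I" "u \<noteq> u'" for u u'
  proof -
    obtain v where v: "v \<noteq> v0" "u v \<noteq> u' v"
      using PiE_ext[OF u(1,2)[unfolded I_def]] u(3) by auto
    have *: "(S + 1) * (1 + i) + S < (S + 1) * (1 + j)" if "i < j" for i j
    proof -
      have "(S + 1) * (1 + i) + S < (S + 1) * (1 + Suc i)" by simp
      also have "\<dots> \<le> (S + 1) * (1 + j)" using that by (intro mult_left_mono) auto
      finally show ?thesis .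
    qed
    have "u v < u' v \<or> u' v < u v" using v(2) by auto
    then show ?thesis using v(1) by (intro exI[of _ v]) (auto simp: c dest: *)
  qed
  show thesis
  proof
    show "finite I" unfolding I_def by (intro finite_PiE) auto
    show "card I = R ^ (CARD('n) - 1)"
      unfolding I_def by (simp add: card_PiE card_Diff_singleton)
    show "S < Poly_Mapping.lookup (c u) v" if "u \<in> I" for u v
      using sum_less[OF that] by (auto simp: c)
    show "disjoint_family_on (\<lambda>i. block D (c i)) I"
      unfolding disjoint_family_on_def
    proof (intro ballI impI)
      fix u u' assume u: "u \<in> I" "u' \<in> I" "u \<noteq> u'"
      from far[OF this] show "block D (c u) \<inter> block D (c u') = {}"
        using blocks_disjoint[OF deg[OF u(1)] deg[OF u(2)]] blocks_disjoint[OF deg[OF u(2)] deg[OF u(1)]]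
        by (elim exE disjE) (simp_all add: Int_commute)
    qed
  qed (rule deg)
qed

text \<open>A Scarf ideal shows no pattern from \<open>\<P>\<close> in any of the
  \<open>R ^ (CARD('n) - 1)\<close> disjoint blocks, and each block shows one with probability at
  least \<open>q\<close>, independently.\<close>

lemma prob_scarf_le:
  fixes \<P> :: "('n::finite \<Rightarrow> nat) set set"
  assumes D: "D > 0" and p: "0 \<le> p" "p \<le> 1" and R: "(CARD('n) - 1) * (S + 1) * R < D"
    and \<P>: "\<P> \<subseteq> Pow (cofactors S)"
    and obstr: "\<And>P (c :: 'n expvec). P \<in> \<P> \<Longrightarrow> (\<And>v. S < Poly_Mapping.lookup c v) \<Longrightarrow>
      scarf_obstruction (codivisor c ` P)"
    and q: "q \<le> (\<Sum>P\<in>\<P>. subset_weight p (cofactors S) P)" and q1: "q \<le> 1"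
  shows "measure_pmf.prob (random_monomial_ideal D p :: ('n, 'k::field) mpoly set pmf) {M. is_scarf M}
    \<le> (1 - q) ^ (R ^ (CARD('n) - 1))"
proof -
  obtain c :: "('n \<Rightarrow> nat) \<Rightarrow> 'n expvec" and I where I: "finite I" "card I = R ^ (CARD('n) - 1)"
    and deg: "\<And>i. i \<in> I \<Longrightarrow> total_degree (c i) = D + S"
    and c: "\<And>i v. i \<in> I \<Longrightarrow> S < Poly_Mapping.lookup (c i) v"
    and disj: "disjoint_family_on (\<lambda>i. block D (c i)) I"
    by (rule disjoint_blocks_exist[OF R]) (rule that; assumption)
  let ?U = "monomials_of_degree D :: 'n expvec set"
  let ?\<W> = "\<lambda>i. (`) (codivisor (c i)) ` \<P>"
  have gen: "random_generators D p = random_subset ?U p"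
    by (simp add: random_generators_def random_subset_def)
  have block: "block D (c i) = codivisor (c i) ` cofactors S" if "i \<in> I" for i
    using c[OF that] deg[OF that] by (intro block_eq_codivisors) (auto intro: less_imp_le)
  have inj: "inj_on (codivisor (c i)) (cofactors S)" if "i \<in> I" for i
    using c[OF that] by (intro inj_on_codivisor) (auto intro: less_imp_le)
  have prob: "q \<le> measure_pmf.prob (random_subset ?U p) {G. G \<inter> block D (c i) \<in> ?\<W> i}" if i: "i \<in> I" for i
  proof -
    have w: "subset_weight p (codivisor (c i) ` cofactors S) (codivisor (c i) ` P) = subset_weight p (cofactors S) P"
      if "P \<in> \<P>" for P
    proof -
      have "P \<subseteq> cofactors S" using that \<P> by auto
      then show ?thesis
        using inj[OF i] unfolding subset_weight_def
        by (simp flip: inj_on_image_set_diff[OF inj[OF i] Diff_subset] add: card_image inj_on_subset inj_on_diff)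
    qed
    have "inj_on ((`) (codivisor (c i))) \<P>"
      using inj_on_image_Pow[OF inj[OF i]] \<P> by (rule inj_on_subset)
    then have "(\<Sum>W\<in>?\<W> i. subset_weight p (block D (c i)) W) = (\<Sum>P\<in>\<P>. subset_weight p (cofactors S) P)"
      unfolding block[OF i] using w by (subst sum.reindex) auto
    moreover have "measure_pmf.prob (random_subset ?U p) {G. G \<inter> block D (c i) \<in> ?\<W> i}
        = (\<Sum>W\<in>?\<W> i. subset_weight p (block D (c i)) W)"
      using \<P> block[OF i] by (intro prob_random_subset_Int_in finite_monomials_of_degree block_subset p) auto
    ultimately show ?thesis using q by simp
  qed
  have "measure_pmf.prob (random_monomial_ideal D p :: ('n, 'k) mpoly set pmf) {M. is_scarf M}
      = measure_pmf.prob (random_subset ?U p) {G. is_scarf (ideal_gen (mpoly_monom ` G) :: ('n, 'k) mpoly set)}"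
    unfolding random_monomial_ideal_def gen by (simp add: measure_map_pmf vimage_def)
  also have "\<dots> \<le> measure_pmf.prob (random_subset ?U p) {G. \<forall>i\<in>I. G \<inter> block D (c i) \<notin> ?\<W> i}"
  \<comment> \<open>The inclusion of events is shown only for sets \<open>G\<close> of monomials of
    degree \<open>D\<close>, that is, on the support.\<close>
  proof (rule measure_pmf.finite_measure_mono_AE)
    show "AE G in random_subset ?U p. G \<in> {G. is_scarf (ideal_gen (mpoly_monom ` G) :: ('n, 'k) mpoly set)}
        \<longrightarrow> G \<in> {G. \<forall>i\<in>I. G \<inter> block D (c i) \<notin> ?\<W> i}"
    proof (rule AE_pmfI, intro impI CollectI ballI notI)
      fix G i assume "G \<in> set_pmf (random_subset ?U p)"
      then have G: "G \<subseteq> ?U" by (auto simp: random_subset_def)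
      assume scarf: "G \<in> {G. is_scarf (ideal_gen (mpoly_monom ` G) :: ('n, 'k) mpoly set)}"
        and i: "i \<in> I" and "G \<inter> block D (c i) \<in> ?\<W> i"
      then obtain P where P: "P \<in> \<P>" "G \<inter> block D (c i) = codivisor (c i) ` P" by auto
      have "{g \<in> G. g \<preceq> c i} = G \<inter> block D (c i)" using G by (auto simp: block_def)
      then have "scarf_obstruction {g \<in> G. g \<preceq> c i}" using obstr[OF P(1) c[OF i]] P(2) by simp
      then show False using not_scarf_if_obstruction[OF G D] scarf by blast
    qed
  qed auto
  also have "\<dots> \<le> (1 - q) ^ card I"
    using \<P> block
    by (intro prob_random_subset_avoid_blocks finite_monomials_of_degree p I block_subset disj prob q1) auto
  finally show ?thesis using I(2) by simp
qed

subsection \<open>Obstructing patterns\<close>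

text \<open>With side 1 the block consists of the quotients of the corner by single variables, and
  any two of them already have the corner as lcm. Take \<open>N = 2\<close>, let \<tau> single out
  one member \<open>y a\<close> and send all others to 1; a pair is then a proper subset because
  there are at least three members.\<close>

lemma scarf_obstruction_corner:
  fixes c :: "'n::finite expvec"
  assumes n: "CARD('n) \<ge> 3" and c: "\<And>v. 1 < Poly_Mapping.lookup c v"
  shows "scarf_obstruction (codivisor c ` cofactors 1)"
proof -
  let ?W = "codivisor c ` cofactors 1"
  define y where "y = (\<lambda>v. codivisor c (\<lambda>w. if w = v then 1 else 0))"
  have ly: "Poly_Mapping.lookup (y v) w = Poly_Mapping.lookup c w - (if w = v then 1 else 0)" for v w
    by (simp add: y_def)
  have W: "?W = range y"
  proof -
    have "s \<in> cofactors 1 \<longleftrightarrow> (\<exists>v. s = (\<lambda>w. if w = v then 1 else 0))" for s :: "'n \<Rightarrow> nat"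
    proof
      assume s: "s \<in> cofactors 1"
      then have "sum s UNIV = 1" by (simp add: cofactors_def)
      then obtain v where v: "s v = 1" "\<And>w. w \<noteq> v \<Longrightarrow> s w = 0"
        using sum_eq_1_iff[of UNIV s] by auto
      then show "\<exists>v. s = (\<lambda>w. if w = v then 1 else 0)" by (intro exI[of _ v]) auto
    qed (auto simp: cofactors_def)
    then have "(cofactors 1 :: ('n \<Rightarrow> nat) set) = range (\<lambda>v w. if w = v then 1 else 0 :: nat)"
      by (intro set_eqI) (simp only: full_SetCompr_eq[symmetric] mem_Collect_eq)
    then show ?thesis by (simp add: y_def image_image)
  qed
  have y_inj: "y v = y w \<longleftrightarrow> v = w" for v w
  proof
    assume "y v = y w"
    then have "Poly_Mapping.lookup (y v) v = Poly_Mapping.lookup (y w) v" by simp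
    then show "v = w" using c[of v] by (auto simp: ly split: if_splits)
  qed simp
  have "card (range y) = CARD('n)" using y_inj by (intro card_image injI) blast
  then have cardW: "card ?W \<ge> 3" using n W by simp
  fix a :: 'n
  have "\<not> UNIV \<subseteq> {a}" using card_mono[of "{a}" UNIV] n by auto
  then obtain b where ab: "b \<noteq> a" by auto
  define \<tau> where "\<tau> = (\<lambda>w. if w = y a then 0 else 1 :: nat)"
  let ?z = "\<lambda>i :: nat. if i = 0 then y a else y b"
  show ?thesis
    unfolding scarf_obstruction_def
  proof (intro exI[of _ "2 :: nat"] exI[of _ ?z] exI[of _ \<tau>] conjI allI impI ballI)
    show "?z ` {..<2} \<subseteq> ?W" unfolding W by auto
  next
    fix A :: "nat set" and w
    assume A: "A \<subseteq> {..<2}" and w: "w \<in> ?W" and le: "\<forall>v. Poly_Mapping.lookup w v = 0 \<or>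
      (\<exists>i\<in>A. Poly_Mapping.lookup w v \<le> Poly_Mapping.lookup (?z i) v)"
    obtain x where x: "w = y x" using w W by auto
    show "\<tau> w \<in> A"
    proof (cases "x = a")
      case True
      then obtain i where "i \<in> A" "Poly_Mapping.lookup c b \<le> Poly_Mapping.lookup (?z i) b"
        using le[rule_format, of b] c[of b] ab by (auto simp: x ly)
      then have "i = 0" using c[of b] by (auto simp: ly split: if_splits)
      then show ?thesis using \<open>i \<in> A\<close> True by (simp add: \<tau>_def x)
    next
      case False
      then obtain i where i: "i \<in> A" "Poly_Mapping.lookup c a \<le> Poly_Mapping.lookup (?z i) a"
        using le[rule_format, of a] c[of a] by (auto simp: x ly)
      then have "i \<noteq> 0" using c[of a] by (auto simp: ly split: if_splits)
      then have "i = 1" using i(1) A by auto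
      then show ?thesis using i(1) False by (simp add: \<tau>_def x y_inj)
    qed
  next
    fix J assume J: "J \<subseteq> ?W" "bij_betw \<tau> J {..<2}"
    have "card J = 2" using bij_betw_same_card[OF J(2)] by simp
    then show "J \<noteq> ?W" using cardW by auto
    fix w v assume "w \<in> ?W"
    then obtain x where x: "w = y x" using W by auto
    have im: "\<tau> ` J = {..<2}" using J(2) by (rule bij_betw_imp_surj_on)
    have "0 \<in> \<tau> ` J" "1 \<in> \<tau> ` J" unfolding im by auto
    then obtain u0 u1 where u: "u0 \<in> J" "\<tau> u0 = 0" "u1 \<in> J" "\<tau> u1 = 1" by (metis imageE)
    have u0: "u0 = y a" using u(2) by (auto simp: \<tau>_def split: if_splits)
    obtain z where z: "u1 = y z" using u(3) J(1) unfolding W by blast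
    have "z \<noteq> a" using u(4) by (auto simp: \<tau>_def z)
    show "\<exists>u\<in>J. Poly_Mapping.lookup w v \<le> Poly_Mapping.lookup u v"
    proof (cases "v = a")
      case True
      then show ?thesis using z u(3) \<open>z \<noteq> a\<close> by (intro bexI[of _ u1]) (auto simp: x ly)
    next
      case False
      then show ?thesis using u0 u(1) by (intro bexI[of _ u0]) (auto simp: x ly)
    qed
  qed
qed

text \<open>In \<open>facet_cofactors b S v\<close> the exponent of \<open>v\<close> is the unique small one, so in any family with
  one member from each of these sets the lcm has the exponent of the \<open>v\<close>-th member at \<open>v\<close>.\<close>

definition facet_cofactors :: "nat \<Rightarrow> nat \<Rightarrow> 'n::finite \<Rightarrow> ('n \<Rightarrow> nat) set" where
  "facet_cofactors b S v = {s \<in> cofactors S. s v < b \<and> (\<forall>w. w \<noteq> v \<longrightarrow> b \<le> s w)}"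

lemma facet_cofactors_unique:
  "s \<in> facet_cofactors b S v \<Longrightarrow> s \<in> facet_cofactors b S w \<Longrightarrow> v = w"
  by (rule ccontr) (fastforce simp: facet_cofactors_def)

text \<open>Here \<tau> numbers the facets. At \<open>v\<close> the exponent of a member of facet
  \<open>v\<close> exceeds those of all other facets, which gives the first condition. One member
  from each facet attains the overall lcm, since \<open>h\<close> and \<open>g v0\<close> tie at
  \<open>v0\<close>, but such a family omits one of these two.\<close>

lemma scarf_obstruction_facets:
  fixes c :: "'n::finite expvec"
  assumes c: "\<And>v. S < Poly_Mapping.lookup c v"
    and g: "\<And>v. g v \<in> facet_cofactors b S v"
    and h: "h \<in> facet_cofactors b S v0" "h v0 = g v0 v0" "h \<noteq> g v0"
  shows "scarf_obstruction (codivisor c ` insert h (range g))"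
proof -
  let ?P = "insert h (range g)" and ?F = "facet_cofactors b S"
  let ?W = "codivisor c ` ?P"
  have PF: "\<exists>v. s \<in> ?F v" if "s \<in> ?P" for s using that g h(1) by auto
  have PS: "?P \<subseteq> cofactors S" using g h(1) by (auto simp: facet_cofactors_def)
  have inj: "inj_on (codivisor c) ?P"
    using inj_on_codivisor[of S c] c PS by (meson inj_on_subset less_imp_le)
  obtain e :: "nat \<Rightarrow> 'n" where e: "bij_betw e {..<CARD('n)} UNIV"
    using ex_bij_betw_nat_finite[OF finite_class.finite_UNIV[where 'a = 'n]] by (auto simp: atLeast0LessThan)
  define e' where "e' = inv_into {..<CARD('n)} e"
  have e': "e' v < CARD('n)" "e (e' v) = v" for v
    using bij_betw_inv_into[OF e] bij_betw_inv_into_right[OF e]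
    by (auto simp: e'_def bij_betw_def)
  have ee: "e' (e i) = i" if "i < CARD('n)" for i
    using that bij_betw_inv_into_left[OF e] by (simp add: e'_def)
  \<comment> \<open>The cofactor is recovered by inverting \<open>codivisor c\<close> on the
    pattern; the facet containing it is unique.\<close>
  define \<tau> where "\<tau> = (\<lambda>w. e' (THE v. inv_into ?P (codivisor c) w \<in> ?F v))"
  have \<tau>: "\<tau> (codivisor c s) = e' v" if "s \<in> ?P" "s \<in> ?F v" for s v
    using that facet_cofactors_unique[of s b S]
    by (auto simp: \<tau>_def inv_into_f_f[OF inj that(1)] intro!: arg_cong[where f = e'] the_equality)
  show ?thesis
    unfolding scarf_obstruction_def
  proof (intro exI[of _ "CARD('n)"] exI[of _ "\<lambda>i. codivisor c (g (e i))"] exI[of _ \<tau>] conjI allI impI ballI)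
    show "(\<lambda>i. codivisor c (g (e i))) ` {..<CARD('n)} \<subseteq> ?W" by auto
  next
    fix A :: "nat set" and w
    assume A: "A \<subseteq> {..<CARD('n)}" and w: "w \<in> ?W" and le: "\<forall>v. Poly_Mapping.lookup w v = 0 \<or>
      (\<exists>i\<in>A. Poly_Mapping.lookup w v \<le> Poly_Mapping.lookup (codivisor c (g (e i))) v)"
    from w obtain s where s: "w = codivisor c s" "s \<in> ?P" by (rule imageE)
    obtain v where v: "s \<in> ?F v" using PF[OF s(2)] ..
    have sv: "s v < b" "s v \<le> S" using v cofactor_le[of s S v] by (auto simp: facet_cofactors_def)
    then obtain i where i: "i \<in> A"
      "Poly_Mapping.lookup c v - s v \<le> Poly_Mapping.lookup c v - g (e i) v"
      using le[rule_format, of v] c[of v] by (auto simp: s(1))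
    have "g (e i) v \<le> S" using g[of "e i"] by (intro cofactor_le) (auto simp: facet_cofactors_def)
    then have "g (e i) v < b" using i(2) sv c[of v] by linarith
    then have "v = e i" using g[of "e i"] by (auto simp: facet_cofactors_def not_le[symmetric])
    then show "\<tau> w \<in> A" using \<tau>[OF s(2) v] i(1) A ee[of i] by (auto simp: s(1))
  next
    fix J assume J: "J \<subseteq> ?W" "bij_betw \<tau> J {..<CARD('n)}"
    show "J \<noteq> ?W"
    proof
      assume "J = ?W"
      then have "inj_on \<tau> ?W" using J(2) by (simp add: bij_betw_def)
      moreover have "\<tau> (codivisor c h) = \<tau> (codivisor c (g v0))"
        using \<tau>[of h v0] \<tau>[of "g v0" v0] g[of v0] h(1) by simp
      ultimately have "codivisor c h = codivisor c (g v0)" by (rule inj_onD) auto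
      then show False using inj_onD[OF inj, of h "g v0"] h(3) by auto
    qed
    fix w u assume "w \<in> ?W"
    then obtain s where s: "w = codivisor c s" "s \<in> ?P" by (rule imageE)
    have "e' u \<in> \<tau> ` J" using J(2) e'(1)[of u] by (simp add: bij_betw_def)
    then obtain z where z: "z \<in> J" "\<tau> z = e' u" by (metis imageE)
    then have "z \<in> ?W" using J(1) by blast
    then obtain t where t: "z = codivisor c t" "t \<in> ?P" by (rule imageE)
    obtain v where "t \<in> ?F v" using PF[OF t(2)] ..
    then have tu: "t \<in> ?F u" using \<tau>[OF t(2), of v] z(2) t(1) e'(2) by metis
    have "t u \<le> s u"
    proof (cases "s \<in> ?F u")
      case True
      have "x = g u \<or> (x = h \<and> u = v0)" if "x \<in> ?P" "x \<in> ?F u" for x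
        using that g h(1) facet_cofactors_unique[of x b S] by auto
      then have *: "x u = g u u" if "x \<in> ?P" "x \<in> ?F u" for x using that h(2) by metis
      show ?thesis using *[OF s(2) True] *[OF t(2) tu] by simp
    next
      case False
      obtain v where v: "s \<in> ?F v" using PF[OF s(2)] ..
      then have "v \<noteq> u" using False by auto
      then have "b \<le> s u" using v by (auto simp: facet_cofactors_def)
      then show ?thesis using tu by (auto simp: facet_cofactors_def)
    qed
    then show "\<exists>u'\<in>J. Poly_Mapping.lookup w u \<le> Poly_Mapping.lookup u' u"
      using z(1) by (intro bexI[of _ z]) (auto simp: s(1) t(1))
  qed
qed

section \<open>Counting facet patterns\<close>

lemma card_cofactor_box:
  fixes l w :: "'n::finite \<Rightarrow> nat"
  assumes S: "(\<Sum>v\<in>UNIV - {u}. l v + w v) + b \<le> S"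
  shows "(\<Prod>v\<in>UNIV - {u}. w v)
    \<le> card {s \<in> cofactors S. b \<le> s u \<and> (\<forall>v. v \<noteq> u \<longrightarrow> l v \<le> s v \<and> s v < l v + w v)}"
proof -
  let ?V = "UNIV - {u}"
  let ?B = "PiE ?V (\<lambda>v. {l v..<l v + w v})"
  \<comment> \<open>The other entries range freely over the box; the entry at \<open>u\<close> takes
    the rest of the sum, which the hypothesis keeps at least \<open>b\<close>.\<close>
  let ?f = "\<lambda>r :: 'n \<Rightarrow> nat. r(u := S - sum r ?V)"
  have "(\<Prod>v\<in>?V. w v) = card ?B" by (simp add: card_PiE)
  also have "\<dots> \<le> card {s \<in> cofactors S. b \<le> s u \<and> (\<forall>v. v \<noteq> u \<longrightarrow> l v \<le> s v \<and> s v < l v + w v)}"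
  proof (rule card_inj_on_le)
    show "inj_on ?f ?B"
    proof (rule inj_onI)
      fix r t assume rt: "r \<in> ?B" "t \<in> ?B" "?f r = ?f t"
      show "r = t"
      proof (rule PiE_ext[OF rt(1,2)])
        fix v assume "v \<in> ?V"
        then show "r v = t v" using fun_cong[OF rt(3), of v] by simp
      qed
    qed
    show "?f ` ?B \<subseteq> {s \<in> cofactors S. b \<le> s u \<and> (\<forall>v. v \<noteq> u \<longrightarrow> l v \<le> s v \<and> s v < l v + w v)}"
    proof (intro image_subsetI CollectI conjI)
      fix r assume r: "r \<in> ?B"
      then have "sum r ?V \<le> (\<Sum>v\<in>?V. l v + w v)" by (intro sum_mono) (auto simp: PiE_iff less_imp_le)
      then have le: "sum r ?V + b \<le> S" using S by linarith
      have "sum (?f r) UNIV = ?f r u + sum (?f r) ?V" by (rule sum.remove) auto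
      also have "sum (?f r) ?V = sum r ?V" by (rule sum.cong) auto
      finally show "?f r \<in> cofactors S" using le by (simp add: cofactors_def)
      show "b \<le> ?f r u" using le by simp
      show "\<forall>v. v \<noteq> u \<longrightarrow> l v \<le> ?f r v \<and> ?f r v < l v + w v" using r by (auto simp: PiE_iff)
    qed
  qed auto
  finally show ?thesis .
qed

text \<open>The source of the side \<open>2 * CARD('n) * b\<close>: one interval may end at
  \<open>3 * b\<close>, the others end by \<open>2 * b\<close>, and \<open>b\<close> is reserved for
  \<open>u\<close>.\<close>

lemma sum_box_le:
  fixes a :: "'n::finite \<Rightarrow> nat"
  assumes "\<And>v. a v \<le> 2 * b + (if v = w then b else 0)" "2 * CARD('n) * b \<le> S"
  shows "(\<Sum>v\<in>UNIV - {u}. a v) + b \<le> S"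
proof -
  have "(\<Sum>v\<in>UNIV - {u}. a v) \<le> (\<Sum>v\<in>UNIV - {u}. 2 * b) + (\<Sum>v\<in>UNIV - {u}. if v = w then b else 0)"
    unfolding sum.distrib[symmetric] by (intro sum_mono assms(1))
  also have "(\<Sum>v\<in>UNIV - {u}. if v = w then b else 0) \<le> b"
    by (subst sum.delta) auto
  also have "(\<Sum>v\<in>UNIV - {u}. 2 * b) = (CARD('n) - 1) * (2 * b)"
    by (simp add: card_Diff_singleton)
  finally have "(\<Sum>v\<in>UNIV - {u}. a v) + b \<le> (CARD('n) - 1) * (2 * b) + 2 * b" by simp
  also have "\<dots> = (CARD('n) - 1 + 1) * (2 * b)" by (simp only: add_mult_distrib mult_1)
  also have "\<dots> = 2 * CARD('n) * b" by simp
  finally show ?thesis using assms(2) by (rule order_trans)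
qed

lemma card_facet_cofactors_ge:
  fixes v :: "'n::finite"
  assumes n: "CARD('n) \<ge> 3" and S: "2 * CARD('n) * b \<le> S"
  shows "b ^ (CARD('n) - 1) \<le> card (facet_cofactors b S v)"
proof -
  have "\<not> UNIV \<subseteq> {v}" using card_mono[of "{v}" UNIV] n by auto
  then obtain u where u: "u \<noteq> v" by auto
  define l where "l = (\<lambda>x. if x = v then 0 else b)"
  have "b ^ (CARD('n) - 1) = (\<Prod>x\<in>UNIV - {u}. b)" by (simp add: card_Diff_singleton)
  also have "\<dots> \<le> card {s \<in> cofactors S. b \<le> s u \<and> (\<forall>x. x \<noteq> u \<longrightarrow> l x \<le> s x \<and> s x < l x + b)}"
    using S by (intro card_cofactor_box sum_box_le[where w = u]) (auto simp: l_def)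
  also have "\<dots> \<le> card (facet_cofactors b S v)"
  proof (rule card_mono)
    show "finite (facet_cofactors b S v)" by (simp add: facet_cofactors_def)
    show "{s \<in> cofactors S. b \<le> s u \<and> (\<forall>x. x \<noteq> u \<longrightarrow> l x \<le> s x \<and> s x < l x + b)} \<subseteq> facet_cofactors b S v"
      using u unfolding facet_cofactors_def l_def by (auto split: if_splits)
  qed
  finally show ?thesis .
qed

text \<open>Fixing the entry at \<open>v0\<close> to \<sigma> creates the tie and costs one
  dimension. The intervals at \<open>v1\<close> for \<open>k = 1\<close> and \<open>k = 2\<close>
  are disjoint, so the two tied members are distinct and can be told apart.\<close>

lemma card_facet_cofactors_slice_ge:
  fixes v0 v1 :: "'n::finite"
  assumes n: "CARD('n) \<ge> 3" and S: "2 * CARD('n) * b \<le> S" and v: "v1 \<noteq> v0" and \<sigma>: "\<sigma> < b"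
    and k: "k \<in> {1, 2}"
  shows "b ^ (CARD('n) - 2)
    \<le> card {s \<in> facet_cofactors b S v0. s v0 = \<sigma> \<and> k * b \<le> s v1 \<and> s v1 < (k + 1) * b}"
proof -
  have "\<not> UNIV \<subseteq> {v0, v1}" using card_mono[of "{v0, v1}" UNIV] n v by auto
  then obtain u where u: "u \<noteq> v0" "u \<noteq> v1" by auto
  define l where "l = (\<lambda>x. if x = v0 then \<sigma> else if x = v1 then k * b else b)"
  define w where "w = (\<lambda>x. if x = v0 then 1 else b)"
  let ?B = "{s \<in> cofactors S. b \<le> s u \<and> (\<forall>x. x \<noteq> u \<longrightarrow> l x \<le> s x \<and> s x < l x + w x)}"
  have "b ^ (CARD('n) - 2) = (\<Prod>x\<in>UNIV - {u} - {v0}. b)"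
    using u by (simp add: card_Diff_singleton numeral_2_eq_2)
  also have "\<dots> = (\<Prod>x\<in>UNIV - {u} - {v0}. w x)" by (rule prod.cong) (auto simp: w_def)
  also have "\<dots> = (\<Prod>x\<in>UNIV - {u}. w x)"
    using u by (subst (2) prod.remove[of _ v0]) (auto simp: w_def)
  also have "\<dots> \<le> card ?B"
    using S \<sigma> k by (intro card_cofactor_box sum_box_le[where w = v1]) (auto simp: l_def w_def)
  also have "\<dots> \<le> card {s \<in> facet_cofactors b S v0. s v0 = \<sigma> \<and> k * b \<le> s v1 \<and> s v1 < (k + 1) * b}"
  proof (rule card_mono)
    show "?B \<subseteq> {s \<in> facet_cofactors b S v0. s v0 = \<sigma> \<and> k * b \<le> s v1 \<and> s v1 < (k + 1) * b}"
    proof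
      fix s assume s: "s \<in> ?B"
      have s0: "s v0 = \<sigma>" using s u v by (auto simp: l_def w_def dest!: spec[of _ v0])
      have s1: "k * b \<le> s v1 \<and> s v1 < (k + 1) * b" using s u v by (auto simp: l_def w_def dest!: spec[of _ v1])
      have "b \<le> s x" if "x \<noteq> v0" for x
        using s s1 that k by (cases "x = u"; cases "x = v1") (auto simp: l_def w_def dest!: spec[of _ x])
      then show "s \<in> {s \<in> facet_cofactors b S v0. s v0 = \<sigma> \<and> k * b \<le> s v1 \<and> s v1 < (k + 1) * b}"
        using s s0 s1 \<sigma> by (simp add: facet_cofactors_def)
    qed
  qed (simp add: facet_cofactors_def)
  finally show ?thesis .
qed

text \<open>A pattern is given by a common value \<sigma>, a tied pair \<open>x\<close>,
  \<open>y\<close> from the two slices of facet \<open>v0\<close>, and one member of each other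
  facet.\<close>

lemma obstructing_patterns_exist:
  assumes n: "CARD('n) \<ge> 3" and S: "2 * CARD('n) * b \<le> S"
  obtains \<P> :: "('n::finite \<Rightarrow> nat) set set"
  where "\<P> \<subseteq> Pow (cofactors S)" "\<And>P. P \<in> \<P> \<Longrightarrow> card P = CARD('n) + 1"
    "b ^ (CARD('n)\<^sup>2 - 2) \<le> card \<P>"
    "\<And>P (c :: 'n expvec). P \<in> \<P> \<Longrightarrow> (\<And>v. S < Poly_Mapping.lookup c v) \<Longrightarrow>
      scarf_obstruction (codivisor c ` P)"
proof -
  fix v0 :: 'n
  have "\<not> UNIV \<subseteq> {v0}" using card_mono[of "{v0}" UNIV] n by auto
  then obtain v1 where v1: "v1 \<noteq> v0" by auto
  let ?F = "facet_cofactors b S :: 'n \<Rightarrow> _" and ?V = "UNIV - {v0}"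
  define slice where "slice = (\<lambda>k \<sigma>. {s \<in> ?F v0. s v0 = \<sigma> \<and> k * b \<le> s v1 \<and> s v1 < (k + 1) * b})"
  define \<Theta> where "\<Theta> = (SIGMA \<sigma>:{..<b}. (slice 1 \<sigma> \<times> slice 2 \<sigma>) \<times> PiE ?V ?F)"
  define pat where "pat = (\<lambda>(\<sigma> :: nat, (x, y), f).
    insert y (range (f(v0 := x))) :: ('n \<Rightarrow> nat) set)"
  have finF: "finite (?F v)" for v by (simp add: facet_cofactors_def)
  have \<Theta>: "\<And>v. (f(v0 := x)) v \<in> ?F v" "y \<in> ?F v0" "x \<in> ?F v0" "x v0 = \<sigma>" "y v0 = \<sigma>" "x v1 < 2 * b" "2 * b \<le> y v1"
      "f \<in> PiE ?V ?F"
    if "(\<sigma>, (x, y), f) \<in> \<Theta>" for \<sigma> x y f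
    using that by (auto simp: \<Theta>_def slice_def PiE_iff)
  have pat_cases: "z = (if v = v0 then x else f v) \<or> (v = v0 \<and> z = y)"
    if "(\<sigma>, (x, y), f) \<in> \<Theta>" "z \<in> pat (\<sigma>, (x, y), f)" "z \<in> ?F v" for \<sigma> x y f z v
  proof -
    have "z = y \<or> z \<in> range (f(v0 := x))"
      using that(2) by (simp only: pat_def prod.case insert_iff)
    then consider "z = y" | w where "z = (f(v0 := x)) w" by blast
    then show ?thesis
    proof cases
      case 1
      then show ?thesis using facet_cofactors_unique[OF that(3)] \<Theta>(2)[OF that(1)] by auto
    next
      case 2
      then have "v = w" using facet_cofactors_unique[OF that(3)] \<Theta>(1)[OF that(1), of w] by simp
      then show ?thesis using 2 by simp
    qed
  qed
  \<comment> \<open>The facets recover \<open>f\<close>; on facet \<open>v0\<close> the entry at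
    \<open>v1\<close> is below \<open>2 * b\<close> for \<open>x\<close> and at least
    \<open>2 * b\<close> for \<open>y\<close>, so the unordered set determines both.\<close>
  have inj: "inj_on pat \<Theta>"
  proof (rule inj_onI)
    fix t t' assume t: "t \<in> \<Theta>" "t' \<in> \<Theta>" "pat t = pat t'"
    obtain \<sigma> x y f where t1: "t = (\<sigma>, (x, y), f)" by (metis surj_pair)
    obtain \<sigma>' x' y' f' where t2: "t' = (\<sigma>', (x', y'), f')" by (metis surj_pair)
    note tt = t1 t2
    note T = \<Theta>[OF t(1)[unfolded tt]] and T' = \<Theta>[OF t(2)[unfolded tt]]
    have mem: "y' \<in> pat t'" "(f'(v0 := x')) v \<in> pat t'" for v
      unfolding tt pat_def prod.case by (rule insertI1) (rule insertI2, rule rangeI)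
    have c: "z = (if v = v0 then x else f v) \<or> (v = v0 \<and> z = y)" if "z \<in> pat t'" "z \<in> ?F v" for z v
      using pat_cases[OF t(1)[unfolded tt(1)], of z v] that t(3) by (simp add: tt(1))
    have "x' = x" using c[OF mem(2)[of v0] T'(1)[of v0]] T(7) T'(6) by auto
    moreover have "y' = y" using c[OF mem(1) T'(2)] T(6) T'(7) by auto
    moreover have "f' = f"
    proof (rule PiE_ext[OF T'(8) T(8)])
      fix v assume "v \<in> ?V"
      then show "f' v = f v" using c[OF mem(2)[of v] T'(1)[of v]] by simp
    qed
    ultimately show "t = t'" using T(4) T'(4) tt by simp
  qed
  show thesis
  proof
    show "pat ` \<Theta> \<subseteq> Pow (cofactors S)"
    proof (intro image_subsetI PowI)
      fix t assume t: "t \<in> \<Theta>"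
      obtain \<sigma> x y f where tt: "t = (\<sigma>, (x, y), f)" by (metis surj_pair)
      note T = \<Theta>[OF t[unfolded tt]]
      have "?F v \<subseteq> cofactors S" for v by (auto simp: facet_cofactors_def)
      then show "pat t \<subseteq> cofactors S" using T(1,2) unfolding tt pat_def prod.case by blast
    qed
  next
    fix P assume "P \<in> pat ` \<Theta>"
    then obtain \<sigma> x y f where t: "(\<sigma>, (x, y), f) \<in> \<Theta>" "P = insert y (range (f(v0 := x)))"
      by (auto simp: pat_def)
    note T = \<Theta>[OF t(1)]
    have "inj (f(v0 := x))" using T(1) facet_cofactors_unique by (metis injI)
    then have card: "card (range (f(v0 := x))) = CARD('n)" by (rule card_image)
    have "y \<noteq> (f(v0 := x)) v" for v
    proof (cases "v = v0")
      case True
      then show ?thesis using T(6,7) by auto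
    next
      case False
      then show ?thesis using T(1)[of v] T(2) facet_cofactors_unique by metis
    qed
    then have "y \<notin> range (f(v0 := x))" by blast
    from card_insert_disjoint[OF finite_imageI[OF finite_class.finite_UNIV] this]
    show "card P = CARD('n) + 1" unfolding t(2) card by simp
    fix c :: "'n expvec" assume c: "\<And>v. S < Poly_Mapping.lookup c v"
    show "scarf_obstruction (codivisor c ` P)"
      unfolding t(2)
    proof (rule scarf_obstruction_facets[OF c T(1) T(2)])
      show "y v0 = (f(v0 := x)) v0 v0" using T(4,5) by simp
      show "y \<noteq> (f(v0 := x)) v0" using T(6,7) by auto
    qed
  next
    let ?n = "CARD('n)"
    obtain m where m: "?n = 3 + m" using le_Suc_ex[OF n] by auto
    \<comment> \<open>One factor \<open>b\<close> for \<sigma>, \<open>?n - 2\<close> for each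
      slice, and \<open>?n - 1\<close> for each of the \<open>?n - 1\<close> other facets.\<close>
    have exp: "?n\<^sup>2 - 2 = 1 + ((?n - 2) + (?n - 2)) + (?n - 1) * (?n - 1)"
      unfolding m by (simp add: power2_eq_square algebra_simps)
    have "b ^ (?n\<^sup>2 - 2) = (\<Sum>\<sigma><b. (b ^ (?n - 2) * b ^ (?n - 2)) * (\<Prod>v\<in>?V. b ^ (?n - 1)))"
      unfolding exp by (simp add: power_add power_mult card_Diff_singleton)
    also have "\<dots> \<le> (\<Sum>\<sigma><b. (card (slice 1 \<sigma>) * card (slice 2 \<sigma>)) * (\<Prod>v\<in>?V. card (?F v)))"
    proof (rule sum_mono)
      fix \<sigma> assume "\<sigma> \<in> {..<b}"
      then have "b ^ (?n - 2) \<le> card (slice k \<sigma>)" if "k \<in> {1, 2}" for k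
        unfolding slice_def using that by (intro card_facet_cofactors_slice_ge[OF n S v1]) auto
      moreover have "(\<Prod>v\<in>?V. b ^ (?n - 1)) \<le> (\<Prod>v\<in>?V. card (?F v))"
        by (rule prod_mono) (use card_facet_cofactors_ge[OF n S] in simp)
      ultimately show "(b ^ (?n - 2) * b ^ (?n - 2)) * (\<Prod>v\<in>?V. b ^ (?n - 1))
          \<le> (card (slice 1 \<sigma>) * card (slice 2 \<sigma>)) * (\<Prod>v\<in>?V. card (?F v))"
        by (intro mult_le_mono) simp_all
    qed
    also have "\<dots> = card \<Theta>"
    proof -
      have "finite (slice k \<sigma>)" for k \<sigma> unfolding slice_def using finF by simp
      then show ?thesis
        unfolding \<Theta>_def using finF
        by (subst card_SigmaI) (auto simp: card_cartesian_product card_PiE intro!: finite_PiE)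
    qed
    also have "\<dots> = card (pat ` \<Theta>)" using inj by (simp add: card_image)
    finally show "b ^ (?n\<^sup>2 - 2) \<le> card (pat ` \<Theta>)" .
  qed
qed

subsection \<open>Quantitative bound and limit\<close>

text \<open>From \<open>ln (1 - p) \<ge> - p - 2 * p\<^sup>2\<close> and
  \<open>p\<^sup>2 \<le> p / 2\<close>.\<close>

lemma exp_minus_double_le:
  fixes p :: real
  assumes "0 \<le> p" "p \<le> 1 / 2"
  shows "exp (- 2 * p) \<le> 1 - p"
proof -
  have "p\<^sup>2 \<le> p * (1 / 2)" unfolding power2_eq_square using assms by (intro mult_left_mono)
  then have "- 2 * p \<le> ln (1 - p)" using ln_one_minus_pos_lower_bound[OF assms] by linarith
  then have "exp (- 2 * p) \<le> exp (ln (1 - p))" by (simp only: exp_le_cancel_iff)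
  then show ?thesis using assms by simp
qed

text \<open>The block has at most \<open>(3 * n * b) ^ (n - 1)\<close> members, where
  \<open>n\<close> is \<open>CARD('n)\<close>, so absence of the members outside a pattern costs
  only a constant. The members of a pattern cost \<open>p ^ (n + 1)\<close>, at least
  \<open>(2 * b)\<close> to the power \<open>-(n\<^sup>2 - 1)\<close>; having
  \<open>b ^ (n\<^sup>2 - 2)\<close> patterns leaves order \<open>1 / b\<close>.\<close>

lemma obstructing_weight_ge:
  fixes p x :: real
  assumes n: "CARD('n) \<ge> 3" and p: "0 \<le> p" "p \<le> 1 / 2"
    and b: "1 \<le> b" "p * real b ^ (CARD('n) - 1) \<le> 1" "1 \<le> p * (2 * real b) ^ (CARD('n) - 1)"
    and card: "\<And>P. P \<in> \<P> \<Longrightarrow> card P = CARD('n) + 1" "b ^ (CARD('n)\<^sup>2 - 2) \<le> card \<P>"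
  shows "exp (- 2 * (3 * real CARD('n)) ^ (CARD('n) - 1)) / 2 ^ (CARD('n)\<^sup>2 - 1) / b
    \<le> (\<Sum>P\<in>\<P>. subset_weight p (cofactors (2 * CARD('n) * b) :: ('n::finite \<Rightarrow> nat) set) P)"
proof -
  let ?n = "CARD('n)" and ?C = "cofactors (2 * CARD('n) * b) :: ('n \<Rightarrow> nat) set"
  let ?K = "exp (- 2 * (3 * real ?n) ^ (?n - 1))"
  have sq: "(?n - 1) * (?n + 1) = ?n\<^sup>2 - 1" "?n\<^sup>2 - 1 = Suc (?n\<^sup>2 - 2)"
  proof -
    obtain m where m: "?n = 3 + m" using le_Suc_ex[OF n] by auto
    show "(?n - 1) * (?n + 1) = ?n\<^sup>2 - 1" "?n\<^sup>2 - 1 = Suc (?n\<^sup>2 - 2)"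
      unfolding m by (simp_all add: power2_eq_square algebra_simps)
  qed
  have K: "?K \<le> (1 - p) ^ card ?C"
  proof -
    have "card ?C \<le> (2 * ?n * b + 1) ^ (?n - 1)" by (rule card_cofactors_le)
    also have "\<dots> \<le> (3 * ?n * b) ^ (?n - 1)"
    proof (rule power_mono)
      have "1 * 1 \<le> ?n * b" using b(1) n by (intro mult_le_mono) auto
      then show "2 * ?n * b + 1 \<le> 3 * ?n * b" by simp
    qed simp
    finally have "real (card ?C) \<le> real ((3 * ?n * b) ^ (?n - 1))" by (simp only: of_nat_le_iff)
    then have "p * card ?C \<le> p * ((3 * real ?n) ^ (?n - 1) * real b ^ (?n - 1))"
      using p by (intro mult_left_mono) (simp_all add: power_mult_distrib)
    also have "\<dots> = (3 * real ?n) ^ (?n - 1) * (p * real b ^ (?n - 1))" by simp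
    also have "\<dots> \<le> (3 * real ?n) ^ (?n - 1) * 1" using b(2) by (intro mult_left_mono) auto
    finally have "?K \<le> exp (- 2 * p * card ?C)" by simp
    also have "\<dots> = exp (- 2 * p) ^ card ?C" by (simp flip: exp_of_nat_mult add: mult.commute)
    also have "\<dots> \<le> (1 - p) ^ card ?C" by (rule power_mono[OF exp_minus_double_le[OF p]]) simp
    finally show ?thesis .
  qed
  have "(1 / 2 ^ (?n - 1)) ^ (?n + 1) \<le> (p * real b ^ (?n - 1)) ^ (?n + 1)"
    using b(3) by (intro power_mono) (simp_all add: power_mult_distrib field_simps)
  also have "\<dots> = p ^ (?n + 1) * real b ^ (?n\<^sup>2 - 1)"
    unfolding power_mult_distrib power_mult[symmetric] sq(1) ..
  also have "\<dots> = p ^ (?n + 1) * (real b ^ (?n\<^sup>2 - 2) * b)"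
    unfolding sq(2) by simp
  finally have w: "1 / 2 ^ (?n\<^sup>2 - 1) / b \<le> real b ^ (?n\<^sup>2 - 2) * p ^ (?n + 1)"
    using b(1) unfolding power_one_over power_mult[symmetric] sq(1) by (simp add: field_simps)
  have "?K / 2 ^ (?n\<^sup>2 - 1) / b = 1 / 2 ^ (?n\<^sup>2 - 1) / b * ?K" by simp
  also have "\<dots> \<le> (real b ^ (?n\<^sup>2 - 2) * p ^ (?n + 1)) * (1 - p) ^ card ?C"
    using p by (intro mult_mono w K) auto
  also have "\<dots> \<le> (card \<P> * p ^ (?n + 1)) * (1 - p) ^ card ?C"
  proof (intro mult_right_mono)
    have "real (b ^ (?n\<^sup>2 - 2)) \<le> card \<P>" using card(2) by (simp only: of_nat_le_iff)
    then show "real b ^ (?n\<^sup>2 - 2) \<le> card \<P>" by simp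
  qed (use p in auto)
  also have "\<dots> = (\<Sum>P\<in>\<P>. p ^ (?n + 1) * (1 - p) ^ card ?C)" by simp
  also have "\<dots> \<le> (\<Sum>P\<in>\<P>. subset_weight p ?C P)"
  proof (rule sum_mono)
    fix P assume "P \<in> \<P>"
    then show "p ^ (?n + 1) * (1 - p) ^ card ?C \<le> subset_weight p ?C P"
      using card(1) p unfolding subset_weight_def
      by (simp only:) (intro mult_left_mono power_decreasing card_mono; simp)
  qed
  finally show ?thesis .
qed

text \<open>The real number \<open>x\<close> is the length scale: corners have mesh at most
  \<open>3 * n * x\<close>, with \<open>n\<close> for \<open>CARD('n)\<close>, which leaves room for
  at least \<open>D / (6 * n\<^sup>2 * x)\<close> of them in each free coordinate.\<close>

lemma prob_scarf_le_exp:
  fixes \<P> :: "('n::finite \<Rightarrow> nat) set set" and x \<kappa> :: real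
  assumes n: "CARD('n) \<ge> 3" and p: "0 \<le> p" "p \<le> 1"
    and \<P>: "\<P> \<subseteq> Pow (cofactors S)"
    and obstr: "\<And>P (c :: 'n expvec). P \<in> \<P> \<Longrightarrow> (\<And>v. S < Poly_Mapping.lookup c v) \<Longrightarrow>
      scarf_obstruction (codivisor c ` P)"
    and x: "1 \<le> x" "real (S + 1) \<le> 3 * real CARD('n) * x" "12 * (real CARD('n))\<^sup>2 * x \<le> real D"
    and \<kappa>: "0 \<le> \<kappa>" "\<kappa> \<le> 1" "\<kappa> / x \<le> (\<Sum>P\<in>\<P>. subset_weight p (cofactors S) P)"
  shows "measure_pmf.prob (random_monomial_ideal D p :: ('n, 'k::field) mpoly set pmf) {M. is_scarf M}
    \<le> exp (- \<kappa> / (6 * (real CARD('n))\<^sup>2) ^ (CARD('n) - 1) * ((real D / x) ^ (CARD('n) - 1) / x))"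
proof -
  let ?n = "CARD('n)"
  define m where "m = (?n - 1) * (S + 1)"
  \<comment> \<open>Dividing \<open>D - 1\<close> instead of \<open>D\<close> gives the strict
    inequality required for placing the corners.\<close>
  define R where "R = (D - 1) div m"
  have "0 < 12 * (real ?n)\<^sup>2 * x" using n x(1) by (intro mult_pos_pos) auto
  then have D: "D > 0" using x(3) by (auto intro: gr0I)
  have m: "m > 0" using n by (simp add: m_def)
  have "m * R \<le> D - 1" unfolding R_def by (rule times_div_less_eq_dividend)
  then have mR: "(?n - 1) * (S + 1) * R < D" using D unfolding m_def by linarith
  have mle: "real m \<le> 3 * (real ?n)\<^sup>2 * x"
  proof -
    have "real m \<le> real ?n * (3 * real ?n * x)"
      unfolding m_def of_nat_mult using x(2) by (intro mult_mono) auto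
    then show ?thesis by (simp add: power2_eq_square)
  qed
  have Rge: "D / (6 * (real ?n)\<^sup>2 * x) \<le> R"
  proof -
    have "D - 1 < m * R + m"
      using m unfolding R_def by (metis dividend_less_times_div mult.commute add.commute)
    then have "D < m * (R + 2)" using m by simp
    then have "real D \<le> m * (real R + 2)" by (metis less_imp_le of_nat_add of_nat_le_iff of_nat_mult of_nat_numeral)
    also have "\<dots> \<le> (3 * (real ?n)\<^sup>2 * x) * (real R + 2)" using mle by (intro mult_right_mono) auto
    finally have "real D \<le> 3 * (real ?n)\<^sup>2 * x * R + 6 * (real ?n)\<^sup>2 * x" by (simp add: algebra_simps)
    \<comment> \<open>The term caused by rounding, \<open>6 * (real ?n)\<^sup>2 * x\<close>, is at
      most half of \<open>D\<close> by the third bound on \<open>x\<close>.\<close>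
    then have "real D \<le> 6 * (real ?n)\<^sup>2 * x * R" using x(3) by linarith
    then show ?thesis using \<open>0 < 12 * (real ?n)\<^sup>2 * x\<close> by (simp add: divide_le_eq mult.commute)
  qed
  let ?q = "\<kappa> / x"
  have q: "0 \<le> ?q" "?q \<le> 1" using \<kappa> x(1) by (auto simp: divide_le_eq)
  have "measure_pmf.prob (random_monomial_ideal D p :: ('n, 'k) mpoly set pmf) {M. is_scarf M}
      \<le> (1 - ?q) ^ (R ^ (?n - 1))"
    by (rule prob_scarf_le[OF D p mR \<P> obstr \<kappa>(3) q(2)])
  also have "\<dots> \<le> exp (- ?q) ^ (R ^ (?n - 1))"
    using q exp_ge_add_one_self[of "- ?q"] by (intro power_mono) auto
  also have "\<dots> = exp (- ?q * real R ^ (?n - 1))" by (simp flip: exp_of_nat_mult add: mult.commute)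
  also have "\<dots> \<le> exp (- ?q * (D / (6 * (real ?n)\<^sup>2 * x)) ^ (?n - 1))"
  proof -
    have "?q * (D / (6 * (real ?n)\<^sup>2 * x)) ^ (?n - 1) \<le> ?q * real R ^ (?n - 1)"
      using q Rge x(1) by (intro mult_left_mono power_mono) auto
    then show ?thesis by simp
  qed
  also have "- ?q * (D / (6 * (real ?n)\<^sup>2 * x)) ^ (?n - 1)
      = - \<kappa> / (6 * (real ?n)\<^sup>2) ^ (?n - 1) * ((real D / x) ^ (?n - 1) / x)"
    by (simp add: power_divide power_mult_distrib)
  finally show ?thesis by simp
qed

text \<open>For \<open>p \<le> 1 / 2\<close> the facet patterns with \<open>b\<close> the integer
  part of \<open>x\<close> are used, for larger \<open>p\<close> the full block of side 1; \<kappa>1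
  and \<kappa>2 are the corresponding constants.\<close>

lemma prob_scarf_bound:
  assumes n: "CARD('n::finite) \<ge> 3"
  obtains C \<kappa> :: real where "\<kappa> > 0"
    "\<And>D p x. 0 < p \<Longrightarrow> p \<le> 1 \<Longrightarrow> x = p powr (- 1 / (real CARD('n) - 1)) \<Longrightarrow> C \<le> (real D / x) ^ (CARD('n) - 1) / x \<Longrightarrow>
      measure_pmf.prob (random_monomial_ideal D p :: ('n, 'k::field) mpoly set pmf) {M. is_scarf M}
        \<le> exp (- \<kappa> * ((real D / x) ^ (CARD('n) - 1) / x))"
proof -
  let ?n = "CARD('n)"
  define \<kappa>1 :: real where "\<kappa>1 = exp (- 2 * (3 * real ?n) ^ (?n - 1)) / 2 ^ (?n\<^sup>2 - 1)"
  define \<kappa>2 :: real where "\<kappa>2 = (1 / 2) ^ card (cofactors 1 :: ('n \<Rightarrow> nat) set)"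
  define \<kappa> where "\<kappa> = min \<kappa>1 \<kappa>2"
  have \<kappa>: "0 < \<kappa>" "\<kappa> \<le> 1" "\<kappa> \<le> \<kappa>1" "\<kappa> \<le> \<kappa>2"
    by (auto simp: \<kappa>_def \<kappa>1_def \<kappa>2_def power_le_one min_le_iff_disj)
  have bound: "measure_pmf.prob (random_monomial_ideal D p :: ('n, 'k) mpoly set pmf) {M. is_scarf M}
        \<le> exp (- \<kappa> / (6 * (real ?n)\<^sup>2) ^ (?n - 1) * ((real D / x) ^ (?n - 1) / x))"
    if p: "0 < p" "p \<le> 1" and x: "x = p powr (- 1 / (real ?n - 1))"
      and C: "(12 * (real ?n)\<^sup>2) ^ (?n - 1) \<le> (real D / x) ^ (?n - 1) / x" for D p x
  proof -
    have x1: "1 \<le> x" unfolding x using p powr_mono'[of "- 1 / (real ?n - 1)" 0 p] n by simp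
    \<comment> \<open>The scale \<open>x\<close> is chosen so that \<open>p * x ^ (?n - 1)\<close>
      is exactly 1.\<close>
    have xn: "p * x ^ (?n - 1) = 1"
    proof -
      have "x ^ (?n - 1) = p powr (- 1 / (real ?n - 1) * real (?n - 1))"
        unfolding x using p by (simp add: powr_powr flip: powr_realpow)
      also have "- 1 / (real ?n - 1) * real (?n - 1) = - 1" using n by (simp add: of_nat_diff)
      finally show ?thesis using p by (simp add: powr_minus)
    qed
    \<comment> \<open>As \<open>x \<ge> 1\<close>, dropping the last division by \<open>x\<close>
      shows that \<open>D / x\<close> is at least \<open>12 * (real ?n)\<^sup>2\<close>.\<close>
    note C
    also have "(real D / x) ^ (?n - 1) / x \<le> (real D / x) ^ (?n - 1) / 1"
      using x1 by (intro divide_left_mono) auto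
    finally have "(12 * (real ?n)\<^sup>2) ^ (?n - 1) \<le> (real D / x) ^ (?n - 1)" by simp
    then have "12 * (real ?n)\<^sup>2 \<le> real D / x"
      by (rule power_mono_iff[THEN iffD1, rotated 3]) (use x1 n in auto)
    then have Dx: "12 * (real ?n)\<^sup>2 * x \<le> real D" using x1 by (simp add: le_divide_eq)
    show ?thesis
    proof (cases "p \<le> 1 / 2")
      case True
      define b where "b = nat \<lfloor>x\<rfloor>"
      have "1 \<le> \<lfloor>x\<rfloor>" using x1 by simp
      \<comment> \<open>Rounding down loses at most a factor 2, hence the two-sided bounds in
        \<open>pb\<close>.\<close>
      then have b: "1 \<le> b" "real b \<le> x" "x \<le> 2 * real b" unfolding b_def by linarith+
      have pb: "p * real b ^ (?n - 1) \<le> 1" "1 \<le> p * (2 * real b) ^ (?n - 1)"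
        unfolding xn[symmetric] using b p by (intro mult_left_mono power_mono; simp)+
      show ?thesis
      proof (rule obstructing_patterns_exist[where b = b, OF n order_refl])
        fix \<P> :: "('n \<Rightarrow> nat) set set"
        assume \<P>: "\<P> \<subseteq> Pow (cofactors (2 * ?n * b))" "\<And>P. P \<in> \<P> \<Longrightarrow> card P = ?n + 1"
          "b ^ (?n\<^sup>2 - 2) \<le> card \<P>"
          "\<And>P (c :: 'n expvec). P \<in> \<P> \<Longrightarrow> (\<And>v. 2 * ?n * b < Poly_Mapping.lookup c v) \<Longrightarrow>
            scarf_obstruction (codivisor c ` P)"
        show ?thesis
        proof (rule prob_scarf_le_exp[OF n _ p(2) \<P>(1) \<P>(4) x1 _ Dx _ \<kappa>(2)])
          have "1 \<le> real ?n * x" using n x1 by (intro mult_ge1_I) auto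
          moreover have "real ?n * b \<le> real ?n * x" using b by (intro mult_left_mono) auto
          ultimately show "real (2 * ?n * b + 1) \<le> 3 * real ?n * x"
            unfolding of_nat_add of_nat_mult of_nat_numeral of_nat_1 by linarith
          have "\<kappa> / x \<le> \<kappa>1 / b" using \<kappa> b by (intro frac_le) auto
          also have "\<dots> \<le> (\<Sum>P\<in>\<P>. subset_weight p (cofactors (2 * ?n * b)) P)"
            unfolding \<kappa>1_def using p True by (intro obstructing_weight_ge n b pb \<P>) auto
          finally show "\<kappa> / x \<le> (\<Sum>P\<in>\<P>. subset_weight p (cofactors (2 * ?n * b)) P)" .
        qed (use p \<kappa> in auto)
      qed
    next
      case False
      show ?thesis
      proof (rule prob_scarf_le_exp[OF n _ p(2) _ _ x1 _ Dx _ \<kappa>(2), where S = 1 and \<P> = "{cofactors 1}"])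
        show "scarf_obstruction (codivisor c ` P)"
          if "P \<in> {cofactors 1}" "\<And>v. 1 < Poly_Mapping.lookup c v" for P and c :: "'n expvec"
          using that scarf_obstruction_corner[OF n] by auto
        have "1 \<le> real ?n * x" using n x1 by (intro mult_ge1_I) auto
        then show "real (1 + 1) \<le> 3 * real ?n * x" by simp
        have "\<kappa> / x \<le> \<kappa>2 / 1" using \<kappa> x1 by (intro frac_le) auto
        also have "\<dots> \<le> p ^ card (cofactors 1 :: ('n \<Rightarrow> nat) set)"
          unfolding \<kappa>2_def using False by (simp only: div_by_1) (intro power_mono; simp)
        finally show "\<kappa> / x \<le> (\<Sum>P\<in>{cofactors 1 :: ('n \<Rightarrow> nat) set}. subset_weight p (cofactors 1) P)"
          by (simp add: subset_weight_def)
      qed (use p \<kappa> in auto)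
    qed
  qed
  show thesis
    by (rule that[of "\<kappa> / (6 * (real ?n)\<^sup>2) ^ (?n - 1)"]) (use bound \<kappa> n in auto)
qed


section \<open>Passage to the limit\<close>

lemma bound_exponent_eq:
  fixes p :: real
  assumes n: "n \<ge> 3" and D: "D \<ge> 1" and p: "0 < p"
  defines "x \<equiv> p powr (- 1 / (real n - 1))"
  shows "(real D / x) ^ (n - 1) / x
    = (p / real D powr (- real n + 2 - 1 / real n)) powr (real n / (real n - 1))"
proof -
  let ?a = "real n / (real n - 1)"
  have n1: "real n - 1 > 0" "real (n - 1) = real n - 1" using n by (auto simp: of_nat_diff)
  have "(real D / x) ^ (n - 1) / x = real D powr (real n - 1) / (x powr (real n - 1) * x powr 1)"
    using D p n1 by (simp add: x_def power_divide flip: powr_realpow)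
  also have "x powr (real n - 1) * x powr 1 = x powr real n" by (simp only: powr_add[symmetric]) simp
  also have "\<dots> = p powr (- ?a)" unfolding x_def by (simp add: powr_powr)
  also have "real D powr (real n - 1) / p powr (- ?a) = p powr ?a / real D powr (- (real n - 1))"
    by (simp only: powr_minus divide_inverse inverse_inverse_eq mult.commute)
  \<comment> \<open>The threshold exponent equals \<open>- (n - 1)\<^sup>2 / n\<close>, so raising
    to the power \<open>n / (n - 1)\<close> produces \<open>- (n - 1)\<close>.\<close>
  also have "- (real n - 1) = (- real n + 2 - 1 / real n) * ?a"
    using n1(1) n by (simp add: field_simps power2_eq_square)
  also have "p powr ?a / real D powr ((- real n + 2 - 1 / real n) * ?a)
      = (p / real D powr (- real n + 2 - 1 / real n)) powr ?a"
    using p D by (simp add: powr_divide powr_powr)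
  finally show ?thesis .
qed

theorem theorem1p3:
  fixes p :: "nat \<Rightarrow> real"
  assumes prob: "\<And>D. D \<ge> 1 \<Longrightarrow> 0 \<le> p D \<and> p D \<le> 1"
    and not_two: "CARD('n::finite) \<noteq> 2"
    and large: "much_less
      (\<lambda>D. real D powr (- real CARD('n) + 2 - 1 / real CARD('n))) p"
  shows "asymptotically_almost_surely
    (\<lambda>D. random_monomial_ideal D (p D) :: ('n, 'k::field) mpoly set pmf)
    (\<lambda>M. \<not> is_scarf M)"
proof -
  let ?n = "CARD('n)"
  define f where "f = (\<lambda>D. real D powr (- real ?n + 2 - 1 / real ?n))"
  have nz: "\<forall>\<^sub>F D in sequentially. p D \<noteq> 0" and lim: "(\<lambda>D. f D / p D) \<longlonglongrightarrow> 0"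
    using large unfolding much_less_def f_def by auto
  have ev: "\<forall>\<^sub>F D in sequentially. D \<ge> 1 \<and> 0 < p D \<and> p D \<le> 1"
    using nz eventually_ge_at_top[of "1 :: nat"] by eventually_elim (use prob in force)
  \<comment> \<open>For one variable the threshold exponent is 0, so the ratio
    \<open>f D / p D\<close> is at least 1 and cannot tend to 0.\<close>
  have "?n \<noteq> 1"
  proof
    assume "?n = 1"
    then have "\<forall>\<^sub>F D in sequentially. 1 \<le> f D / p D"
      using ev by (auto elim!: eventually_mono simp: f_def)
    then have "(1 :: real) \<le> 0" using lim by (intro tendsto_lowerbound[OF lim]) auto
    then show False by simp
  qed
  moreover have "?n > 0" by simp
  ultimately have n: "?n \<ge> 3" using not_two by linarith
  define P where "P = (\<lambda>D. measure_pmf.prob (random_monomial_ideal D (p D) :: ('n, 'k) mpoly set pmf) {M. is_scarf M})"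
  define y where "y = (\<lambda>D. (p D / f D) powr (real ?n / (real ?n - 1)))"
  obtain C \<kappa> :: real where \<kappa>: "\<kappa> > 0" and bound: "\<And>D p x. 0 < p \<Longrightarrow> p \<le> 1 \<Longrightarrow>
      x = p powr (- 1 / (real ?n - 1)) \<Longrightarrow> C \<le> (real D / x) ^ (?n - 1) / x \<Longrightarrow>
      measure_pmf.prob (random_monomial_ideal D p :: ('n, 'k) mpoly set pmf) {M. is_scarf M}
        \<le> exp (- \<kappa> * ((real D / x) ^ (?n - 1) / x))"
    using prob_scarf_bound[OF n, where 'k = 'k] by metis
  have "filterlim (\<lambda>D. inverse (f D / p D)) at_top sequentially"
    using ev by (intro filterlim_inverse_at_top lim) (auto elim!: eventually_mono simp: f_def)
  then have pf: "filterlim (\<lambda>D. p D / f D) at_top sequentially" by (simp add: inverse_eq_divide)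
  \<comment> \<open>The exponent \<open>n / (n - 1)\<close> is at least 1, so \<open>y D\<close>
    dominates \<open>p D / f D\<close> once the latter is at least 1.\<close>
  have y: "filterlim y at_top sequentially"
  proof (rule filterlim_at_top_mono[OF pf])
    show "\<forall>\<^sub>F D in sequentially. p D / f D \<le> y D"
      using filterlim_at_top[THEN iffD1, OF pf, rule_format, of 1]
    proof eventually_elim
      case (elim D)
      have "(p D / f D) powr 1 \<le> y D"
        unfolding y_def using elim n by (intro powr_mono) auto
      moreover have "(p D / f D) powr 1 = p D / f D" using elim by (intro powr_one) linarith
      ultimately show ?case by simp
    qed
  qed
  have upper: "\<forall>\<^sub>F D in sequentially. P D \<le> exp (- \<kappa> * y D)"
    using filterlim_at_top[THEN iffD1, OF y, rule_format, of C] ev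
  proof eventually_elim
    case (elim D)
    let ?x = "p D powr (- 1 / (real ?n - 1))"
    have eq: "(real D / ?x) ^ (?n - 1) / ?x = y D"
      unfolding y_def f_def using elim by (intro bound_exponent_eq[OF n]) auto
    show ?case using bound[of "p D" ?x D, unfolded eq] elim unfolding P_def by blast
  qed
  have vanish: "(\<lambda>D. exp (- \<kappa> * y D)) \<longlonglongrightarrow> 0"
    by (rule filterlim_compose[OF exp_at_bot filterlim_tendsto_neg_mult_at_bot[OF tendsto_const _ y]])
      (use \<kappa> in simp)
  have "\<forall>\<^sub>F D in sequentially. 0 \<le> P D" by (simp add: P_def)
  from tendsto_sandwich[OF this upper tendsto_const vanish] have "P \<longlonglongrightarrow> 0" .
  then have "(\<lambda>D. 1 - P D) \<longlonglongrightarrow> 1 - 0" by (intro tendsto_diff tendsto_const)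
  moreover have "measure_pmf.prob (random_monomial_ideal D (p D) :: ('n, 'k) mpoly set pmf) {M. \<not> is_scarf M} = 1 - P D" for D
    using measure_pmf.prob_compl[of "{M. is_scarf M}" "random_monomial_ideal D (p D) :: ('n, 'k) mpoly set pmf"]
    by (simp add: P_def Compl_eq_Diff_UNIV[symmetric] Collect_neg_eq)
  ultimately show ?thesis unfolding asymptotically_almost_surely_def by simp
qed

end
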